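(* Let $\mathcal{R}$ be a convex DPOI rewriting system over a monoidal signature $\Sigma$. If convex rewriting by $\mathcal{R}$ is locally confluent on all ma-hypergraphs with interface labelled by $\Sigma+\mathcal P$, then all ma-pre-critical pairs of $\mathcal{R}$ are path joinable.
   Context: Hypergraphs over a signature (generators $o:k\to l$): nodes and hyperedges, each hyperedge labelled by a generator $o:k\to l$ with an ordered list of $k$ source and $l$ target nodes; morphisms preserve labels, sources and targets. Formal path generators: a set $\mathcal P$ of three new generators (not in $\Sigma$) of types $2\to1$, $1\to2$, $1\to1$; $\Sigma+\mathcal P$ is the extended signature. A natural number $n$ denotes the discrete hypergraph with $n$ nodes. A path is a sequence of hyperedges $e_1,\dots,e_n$ with some target of $e_k$ a source of $e_{k+1}$; from $v$ to $v'$ if $v$ is a source of $e_1$ and $v'$ a target of $e_n$; a cycle if also some target of $e_n$ is a source of $e_1$. In-/out-degree: number of (hyperedge, position) pairs with the node as target/source; inputs $\mathrm{in}(G)$ have in-degree $0$, outputs $\mathrm{out}(G)$ out-degree $0$. An ma-hypergraph has no cycles and all in-/out-degrees $\le1$. An ma-cospan $n\xrightarrow{f}G\xleftarrow{g}m$: $G$ ma, $f,g$ mono with images $\mathrm{in}(G)$, $\mathrm{out}(G)$. An ma-hypergraph with interface is (up to iso $J\cong n+m$) $[f,g]:n+m\to G$ for an ma-cospan. An ma-rule is $L\leftarrow i+j\rightarrow R$ (with $L,R$ labelled by $\Sigma$) with $i\to L\leftarrow j$, $i\to R\leftarrow j$ ma-cospans. A DPO rewriting step $(G\leftarrow J)\rightsquigarrow(H\leftarrow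 J)$ by $L\leftarrow K\to R$: there are $C$ and maps with $L\leftarrow K\to C\to G$, $R\leftarrow K\to C\to H$ pushouts and $J\to G$, $J\to H$ factoring through some $J\to C$. A match $m:L\to G$ is convex if mono and every hyperedge of every path in $G$ between nodes of $m[L]$ lies in $m[L]$. A convex rewriting step is a DPO step between ma-hypergraphs with interface whose match is convex and whose left pushout complement $i+j\xrightarrow{[c_1,c_2]}C\xrightarrow{g}G$ is a boundary complement: $[c_1,c_2]$ mono and there are $d_1:n\to C$, $d_2:m\to C$ composing with $g$ to the interface legs $n\to G\leftarrow m$ such that $j+n\xrightarrow{[c_2,d_1]}C\xleftarrow{[c_1,d_2]}m+i$ is an ma-cospan. A convex DPOI rewriting system is a set of ma-rules, rewriting by convex steps; it is locally confluent on a class of ma-hypergraphs with interface if every branching $(G_1\leftarrow J)\leftsquigarrow(G_0\leftarrow J)\rightsquigarrow(G_2\leftarrow J)$ of convex steps from an element of the class is joinable by convex rewriting (both sides reach a common ma-hypergraph with interface, up to iso, by finite sequences of convex steps). An ma-pre-critical pair for two rules $L_1\leftarrow K_1\to R_1$, $L_2\leftarrow K_2\to R_2$ of $\mathcal R$ is a pair of DPO steps $(G'_{1,1}\leftarrow J')\leftsquigarrow(G'_0\leftarrow J')\rightsquigarrow(G'_{1,2}\leftarrow J')$ by the two rules with matches $f_1,f_2$ such that $[f_1,f_2]:L_1+L_2\to G'_0$ is epi, the interface maps into $G'_0$ via the two contexts agree, and $G'_0\leftarrow J'$ is an ma-hypergraph with interface. For an ma-hypergraph $G$ and mono $m:G\to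 H$, the path relation $R_m\subseteq\mathrm{out}(G)\times\mathrm{in}(G)$ has $(y,x)\in R_m$ iff there is a path in $H$ from $m(y)$ to $m(x)$. For an ma-hypergraph $G$ and $R\subseteq\mathrm{out}(G)\times\mathrm{in}(G)$, a mono $p:G\to P$ is a path extension (for $R$) if $P$ consists of $p[G]\cong G$ plus additional nodes and $\mathcal P$-labelled hyperedges such that there is a path from the image of an output $y$ to the image of an input $x$ iff $(y,x)\in R$. A maximal path relation for an ma-pre-critical pair based at $G'_0$ is $R\subseteq\mathrm{out}(G'_0)\times\mathrm{in}(G'_0)$ such that (1) there is a mono $m:G'_0\to H$ into an ma-hypergraph $H$ with $R_m=R$, (2) $m\circ f_1$ and $m\circ f_2$ are convex, and (3) no relation satisfying (1),(2) properly contains $R$. The ma-pre-critical pair is path joinable if for every maximal path relation $R$ there is a path extension $p:G'_0\to P$ with $R_p=R$ such that the branching obtained by performing the two rewriting steps of the critical pair at the matches $p\circ f_1$, $p\circ f_2$ in $P$ (contexts obtained by pushout along $p$) is joinable by convex rewriting.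
   Formalization: Hypergraphs are finite; the steps in P are convex steps at p∘f_i, and their contexts are required to be pushouts of the pair's contexts along p only when those contexts are boundary complements (otherwise a wire rule whose context closes a loop is a counterexample). *)

theory Defs
  imports Main
begin

record 's signature =
  gens :: "'s set"
  arity :: "'s \<Rightarrow> nat"
  coarity :: "'s \<Rightarrow> nat"

text \<open>
  The formal path generators are of types $2\to 1$, $1\to 2$ and $1\to 1$.  They are made
  disjoint from the given signature by a sum type, so that \<open>base_sig \<Sigma>\<close> is the given signature
  and \<open>ext_sig \<Sigma>\<close> its extension, both over the type of labels \<open>'s + path_gen\<close>.
\<close>

datatype path_gen = Join | Fork | Wire

fun path_arity :: "path_gen \<Rightarrow> nat" where
  "path_arity Join = 2"
| "path_arity Fork = 1"
| "path_arity Wire = 1"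

fun path_coarity :: "path_gen \<Rightarrow> nat" where
  "path_coarity Join = 1"
| "path_coarity Fork = 2"
| "path_coarity Wire = 1"

definition base_sig :: "'s signature \<Rightarrow> ('s + path_gen) signature" where
  "base_sig \<Sigma> = \<lparr> gens = Inl ` gens \<Sigma>,
                  arity = case_sum (arity \<Sigma>) path_arity,
                  coarity = case_sum (coarity \<Sigma>) path_coarity \<rparr>"

definition ext_sig :: "'s signature \<Rightarrow> ('s + path_gen) signature" where
  "ext_sig \<Sigma> = \<lparr> gens = gens \<Sigma> <+> UNIV,
                 arity = case_sum (arity \<Sigma>) path_arity,
                 coarity = case_sum (coarity \<Sigma>) path_coarity \<rparr>"

text \<open>
  Hypergraphs are finite, so drawing nodes and hyperedges from the natural numbers loses nothing
  up to isomorphism.  The values of the maps outside the carriers are irrelevant.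
\<close>

record 'l hypergraph =
  nodes :: "nat set"
  edges :: "nat set"
  src :: "nat \<Rightarrow> nat list"
  tgt :: "nat \<Rightarrow> nat list"
  lab :: "nat \<Rightarrow> 'l"

definition hypergraph :: "'l signature \<Rightarrow> 'l hypergraph \<Rightarrow> bool" where
  "hypergraph S G \<longleftrightarrow> finite (nodes G) \<and> finite (edges G) \<and>
     (\<forall>e\<in>edges G. lab G e \<in> gens S \<and>
        length (src G e) = arity S (lab G e) \<and> set (src G e) \<subseteq> nodes G \<and>
        length (tgt G e) = coarity S (lab G e) \<and> set (tgt G e) \<subseteq> nodes G)"

text \<open>A morphism is a pair of a node map and an edge map; equality is relative to the domain.\<close>

type_synonym mor = "(nat \<Rightarrow> nat) \<times> (nat \<Rightarrow> nat)"

definition hom :: "'l hypergraph \<Rightarrow> 'l hypergraph \<Rightarrow> mor \<Rightarrow> bool" where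
  "hom G H f \<longleftrightarrow> fst f ` nodes G \<subseteq> nodes H \<and> snd f ` edges G \<subseteq> edges H \<and>
     (\<forall>e\<in>edges G. lab H (snd f e) = lab G e \<and>
        src H (snd f e) = map (fst f) (src G e) \<and>
        tgt H (snd f e) = map (fst f) (tgt G e))"

definition mor_comp :: "mor \<Rightarrow> mor \<Rightarrow> mor" (infixl "\<odot>" 70) where
  "g \<odot> f = (fst g \<circ> fst f, snd g \<circ> snd f)"

definition mor_eq :: "'l hypergraph \<Rightarrow> mor \<Rightarrow> mor \<Rightarrow> bool" where
  "mor_eq G f g \<longleftrightarrow> (\<forall>v\<in>nodes G. fst f v = fst g v) \<and> (\<forall>e\<in>edges G. snd f e = snd g e)"

definition mono_mor :: "'l hypergraph \<Rightarrow> mor \<Rightarrow> bool" where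
  "mono_mor G f \<longleftrightarrow> inj_on (fst f) (nodes G) \<and> inj_on (snd f) (edges G)"

definition pushout ::
  "'l signature \<Rightarrow> 'l hypergraph \<Rightarrow> 'l hypergraph \<Rightarrow> 'l hypergraph \<Rightarrow> 'l hypergraph
     \<Rightarrow> mor \<Rightarrow> mor \<Rightarrow> mor \<Rightarrow> mor \<Rightarrow> bool" where
  "pushout S A B C D f g h k \<longleftrightarrow>
     hypergraph S A \<and> hypergraph S B \<and> hypergraph S C \<and> hypergraph S D \<and>
     hom A B f \<and> hom A C g \<and> hom B D h \<and> hom C D k \<and>
     mor_eq A (h \<odot> f) (k \<odot> g) \<and>
     (\<forall>X u v. hypergraph S X \<and> hom B X u \<and> hom C X v \<and> mor_eq A (u \<odot> f) (v \<odot> g) \<longrightarrow>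
        (\<exists>w. hom D X w \<and> mor_eq B (w \<odot> h) u \<and> mor_eq C (w \<odot> k) v \<and>
           (\<forall>w'. hom D X w' \<and> mor_eq B (w' \<odot> h) u \<and> mor_eq C (w' \<odot> k) v \<longrightarrow> mor_eq D w' w)))"

text \<open>
  The discrete hypergraph on \<open>n\<close> nodes.  The coproduct of \<open>disc n\<close> and \<open>disc m\<close> is \<open>disc (n + m)\<close>,
  whose first \<open>n\<close> nodes form the left summand; \<open>copair n f g\<close> is the morphism $[f,g]$ out of it.
\<close>

definition disc :: "nat \<Rightarrow> 'l hypergraph" where
  "disc n = \<lparr> nodes = {..<n}, edges = {}, src = (\<lambda>_. []), tgt = (\<lambda>_. []), lab = undefined \<rparr>"

definition copair :: "nat \<Rightarrow> mor \<Rightarrow> mor \<Rightarrow> mor" where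
  "copair n f g = ((\<lambda>k. if k < n then fst f k else fst g (k - n)), id)"

definition path :: "'l hypergraph \<Rightarrow> nat list \<Rightarrow> bool" where
  "path G es \<longleftrightarrow> es \<noteq> [] \<and> set es \<subseteq> edges G \<and>
     (\<forall>k. Suc k < length es \<longrightarrow> set (tgt G (es ! k)) \<inter> set (src G (es ! Suc k)) \<noteq> {})"

definition path_from_to :: "'l hypergraph \<Rightarrow> nat \<Rightarrow> nat list \<Rightarrow> nat \<Rightarrow> bool" where
  "path_from_to G v es v' \<longleftrightarrow> path G es \<and> v \<in> set (src G (hd es)) \<and> v' \<in> set (tgt G (last es))"

definition cycle :: "'l hypergraph \<Rightarrow> nat list \<Rightarrow> bool" where
  "cycle G es \<longleftrightarrow> path G es \<and> set (tgt G (last es)) \<inter> set (src G (hd es)) \<noteq> {}"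

definition in_degree :: "'l hypergraph \<Rightarrow> nat \<Rightarrow> nat" where
  "in_degree G v = card {(e, k). e \<in> edges G \<and> k < length (tgt G e) \<and> tgt G e ! k = v}"

definition out_degree :: "'l hypergraph \<Rightarrow> nat \<Rightarrow> nat" where
  "out_degree G v = card {(e, k). e \<in> edges G \<and> k < length (src G e) \<and> src G e ! k = v}"

definition inputs :: "'l hypergraph \<Rightarrow> nat set" where
  "inputs G = {v \<in> nodes G. in_degree G v = 0}"

definition outputs :: "'l hypergraph \<Rightarrow> nat set" where
  "outputs G = {v \<in> nodes G. out_degree G v = 0}"

definition ma_hypergraph :: "'l signature \<Rightarrow> 'l hypergraph \<Rightarrow> bool" where
  "ma_hypergraph S G \<longleftrightarrow> hypergraph S G \<and> (\<nexists>es. cycle G es) \<and>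
     (\<forall>v\<in>nodes G. in_degree G v \<le> 1 \<and> out_degree G v \<le> 1)"

definition ma_cospan ::
  "'l signature \<Rightarrow> nat \<Rightarrow> mor \<Rightarrow> 'l hypergraph \<Rightarrow> mor \<Rightarrow> nat \<Rightarrow> bool" where
  "ma_cospan S n f G g m \<longleftrightarrow> ma_hypergraph S G \<and>
     hom (disc n) G f \<and> mono_mor (disc n :: 'l hypergraph) f \<and> fst f ` {..<n} = inputs G \<and>
     hom (disc m) G g \<and> mono_mor (disc m :: 'l hypergraph) g \<and> fst g ` {..<m} = outputs G"

text \<open>Hypergraphs with interface $[f,g] : n + m \to G$, given by the two legs $f$ and $g$.\<close>

record 'l ihypergraph =
  carrier :: "'l hypergraph"
  dom_size :: nat
  cod_size :: nat
  dom_leg :: mor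
  cod_leg :: mor

definition ma_ihypergraph :: "'l signature \<Rightarrow> 'l ihypergraph \<Rightarrow> bool" where
  "ma_ihypergraph S X \<longleftrightarrow>
     ma_cospan S (dom_size X) (dom_leg X) (carrier X) (cod_leg X) (cod_size X)"

definition interface :: "'l ihypergraph \<Rightarrow> mor" where
  "interface X = copair (dom_size X) (dom_leg X) (cod_leg X)"

definition ihypergraph_iso :: "'l ihypergraph \<Rightarrow> 'l ihypergraph \<Rightarrow> bool" where
  "ihypergraph_iso X Y \<longleftrightarrow> dom_size X = dom_size Y \<and> cod_size X = cod_size Y \<and>
     (\<exists>a b. hom (carrier X) (carrier Y) a \<and> hom (carrier Y) (carrier X) b \<and>
        mor_eq (carrier X) (b \<odot> a) (id, id) \<and> mor_eq (carrier Y) (a \<odot> b) (id, id) \<and>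
        mor_eq (disc (dom_size X + cod_size X) :: 'l hypergraph) (a \<odot> interface X) (interface Y))"

text \<open>Rules $L \leftarrow i + j \to R$.\<close>

record 'l rule =
  rule_i :: nat
  rule_j :: nat
  lhs :: "'l hypergraph"
  lhs_i :: mor
  lhs_j :: mor
  rhs :: "'l hypergraph"
  rhs_i :: mor
  rhs_j :: mor

definition ma_rule :: "'l signature \<Rightarrow> 'l rule \<Rightarrow> bool" where
  "ma_rule S r \<longleftrightarrow> ma_cospan S (rule_i r) (lhs_i r) (lhs r) (lhs_j r) (rule_j r) \<and>
     ma_cospan S (rule_i r) (rhs_i r) (rhs r) (rhs_j r) (rule_j r)"

text \<open>
  The data of a DPO step $(G \leftarrow n+m) \rightsquigarrow (H \leftarrow n+m)$ by
  $L \leftarrow i+j \to R$: the context $C$ with $[c_1,c_2] : i+j \to C$ and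
  $[d_1,d_2] : n+m \to C$, the match $L \to G$ and the maps $C \to G$, $R \to H$, $C \to H$.
\<close>

record 'l dpo_data =
  ctxt :: "'l hypergraph"
  ctxt_i :: mor
  ctxt_j :: mor
  ctxt_dom :: mor
  ctxt_cod :: mor
  mtch :: mor
  ctxt_left :: mor
  comtch :: mor
  ctxt_right :: mor

definition ctxt_rule :: "'l rule \<Rightarrow> 'l dpo_data \<Rightarrow> mor" where
  "ctxt_rule r t = copair (rule_i r) (ctxt_i t) (ctxt_j t)"

definition ctxt_interface :: "'l ihypergraph \<Rightarrow> 'l dpo_data \<Rightarrow> mor" where
  "ctxt_interface X t = copair (dom_size X) (ctxt_dom t) (ctxt_cod t)"

definition dpo_step ::
  "'l signature \<Rightarrow> 'l rule \<Rightarrow> 'l ihypergraph \<Rightarrow> 'l ihypergraph \<Rightarrow> 'l dpo_data \<Rightarrow> bool" where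
  "dpo_step S r X Y t \<longleftrightarrow>
     dom_size Y = dom_size X \<and> cod_size Y = cod_size X \<and>
     pushout S (disc (rule_i r + rule_j r)) (lhs r) (ctxt t) (carrier X)
       (copair (rule_i r) (lhs_i r) (lhs_j r)) (ctxt_rule r t) (mtch t) (ctxt_left t) \<and>
     pushout S (disc (rule_i r + rule_j r)) (rhs r) (ctxt t) (carrier Y)
       (copair (rule_i r) (rhs_i r) (rhs_j r)) (ctxt_rule r t) (comtch t) (ctxt_right t) \<and>
     hom (disc (dom_size X + cod_size X)) (ctxt t) (ctxt_interface X t) \<and>
     mor_eq (disc (dom_size X + cod_size X) :: 'l hypergraph)
       (ctxt_left t \<odot> ctxt_interface X t) (interface X) \<and>
     mor_eq (disc (dom_size X + cod_size X) :: 'l hypergraph)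
       (ctxt_right t \<odot> ctxt_interface X t) (interface Y)"

definition convex_match :: "'l hypergraph \<Rightarrow> 'l hypergraph \<Rightarrow> mor \<Rightarrow> bool" where
  "convex_match L G f \<longleftrightarrow> hom L G f \<and> mono_mor L f \<and>
     (\<forall>v\<in>fst f ` nodes L. \<forall>v'\<in>fst f ` nodes L. \<forall>es.
        path_from_to G v es v' \<longrightarrow> set es \<subseteq> snd f ` edges L)"

text \<open>
  The maps $d_1$, $d_2$ of a boundary complement are those through which the interface factors
  in the step: since $C \to G$ need not be mono, a different factorisation could rewire the
  interface of the result.
\<close>

definition boundary_complement ::
  "'l signature \<Rightarrow> 'l rule \<Rightarrow> 'l ihypergraph \<Rightarrow> 'l dpo_data \<Rightarrow> bool" where
  "boundary_complement S r X t \<longleftrightarrow>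
     mono_mor (disc (rule_i r + rule_j r) :: 'l hypergraph) (ctxt_rule r t) \<and>
     mor_eq (disc (dom_size X) :: 'l hypergraph) (ctxt_left t \<odot> ctxt_dom t) (dom_leg X) \<and>
     mor_eq (disc (cod_size X) :: 'l hypergraph) (ctxt_left t \<odot> ctxt_cod t) (cod_leg X) \<and>
     ma_cospan S
       (rule_j r + dom_size X) (copair (rule_j r) (ctxt_j t) (ctxt_dom t))
       (ctxt t)
       (copair (cod_size X) (ctxt_cod t) (ctxt_i t)) (cod_size X + rule_i r)"

definition convex_step_by ::
  "'l signature \<Rightarrow> 'l rule \<Rightarrow> 'l ihypergraph \<Rightarrow> 'l ihypergraph \<Rightarrow> 'l dpo_data \<Rightarrow> bool" where
  "convex_step_by S r X Y t \<longleftrightarrow>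
     ma_ihypergraph S X \<and> ma_ihypergraph S Y \<and> dpo_step S r X Y t \<and>
     convex_match (lhs r) (carrier X) (mtch t) \<and> boundary_complement S r X t"

definition convex_step ::
  "'l signature \<Rightarrow> 'l rule set \<Rightarrow> 'l ihypergraph \<Rightarrow> 'l ihypergraph \<Rightarrow> bool" where
  "convex_step S \<R> X Y \<longleftrightarrow> (\<exists>r\<in>\<R>. \<exists>t. convex_step_by S r X Y t)"

definition convex_joinable ::
  "'l signature \<Rightarrow> 'l rule set \<Rightarrow> 'l ihypergraph \<Rightarrow> 'l ihypergraph \<Rightarrow> bool" where
  "convex_joinable S \<R> Y\<^sub>1 Y\<^sub>2 \<longleftrightarrow>
     (\<exists>Z\<^sub>1 Z\<^sub>2. (convex_step S \<R>)\<^sup>*\<^sup>* Y\<^sub>1 Z\<^sub>1 \<and> (convex_step S \<R>)\<^sup>*\<^sup>* Y\<^sub>2 Z\<^sub>2 \<and>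
        ma_ihypergraph S Z\<^sub>1 \<and> ma_ihypergraph S Z\<^sub>2 \<and> ihypergraph_iso Z\<^sub>1 Z\<^sub>2)"

definition locally_confluent_on ::
  "'l signature \<Rightarrow> 'l rule set \<Rightarrow> 'l ihypergraph set \<Rightarrow> bool" where
  "locally_confluent_on S \<R> \<C> \<longleftrightarrow>
     (\<forall>X\<in>\<C>. \<forall>Y\<^sub>1 Y\<^sub>2. convex_step S \<R> X Y\<^sub>1 \<and> convex_step S \<R> X Y\<^sub>2 \<longrightarrow>
        convex_joinable S \<R> Y\<^sub>1 Y\<^sub>2)"

definition convex_rewriting_system :: "'s signature \<Rightarrow> ('s + path_gen) rule set \<Rightarrow> bool" where
  "convex_rewriting_system \<Sigma> \<R> \<longleftrightarrow> (\<forall>r\<in>\<R>. ma_rule (base_sig \<Sigma>) r)"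

definition jointly_epi ::
  "'l hypergraph \<Rightarrow> 'l hypergraph \<Rightarrow> 'l hypergraph \<Rightarrow> mor \<Rightarrow> mor \<Rightarrow> bool" where
  "jointly_epi A B G f g \<longleftrightarrow>
     fst f ` nodes A \<union> fst g ` nodes B = nodes G \<and> snd f ` edges A \<union> snd g ` edges B = edges G"

text \<open>
  The steps of a pre-critical pair are arbitrary DPO steps.  Being epi from $L_1 + L_2$ forces
  $G'_0$, and hence the contexts and results, to carry labels of the rules only, even though the
  definition is used with the extended signature.
\<close>

definition ma_pre_critical_pair ::
  "'l signature \<Rightarrow> 'l rule set \<Rightarrow> 'l rule \<Rightarrow> 'l rule \<Rightarrow> 'l ihypergraph \<Rightarrow> 'l ihypergraph
     \<Rightarrow> 'l ihypergraph \<Rightarrow> 'l dpo_data \<Rightarrow> 'l dpo_data \<Rightarrow> bool" where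
  "ma_pre_critical_pair S \<R> r\<^sub>1 r\<^sub>2 X Y\<^sub>1 Y\<^sub>2 t\<^sub>1 t\<^sub>2 \<longleftrightarrow>
     r\<^sub>1 \<in> \<R> \<and> r\<^sub>2 \<in> \<R> \<and>
     dpo_step S r\<^sub>1 X Y\<^sub>1 t\<^sub>1 \<and> dpo_step S r\<^sub>2 X Y\<^sub>2 t\<^sub>2 \<and>
     jointly_epi (lhs r\<^sub>1) (lhs r\<^sub>2) (carrier X) (mtch t\<^sub>1) (mtch t\<^sub>2) \<and>
     mor_eq (disc (dom_size X + cod_size X) :: 'l hypergraph)
       (ctxt_left t\<^sub>1 \<odot> ctxt_interface X t\<^sub>1) (ctxt_left t\<^sub>2 \<odot> ctxt_interface X t\<^sub>2) \<and>
     ma_ihypergraph S X"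

definition path_relation :: "'l hypergraph \<Rightarrow> 'l hypergraph \<Rightarrow> mor \<Rightarrow> (nat \<times> nat) set" where
  "path_relation G H m =
     {(y, x) \<in> outputs G \<times> inputs G. \<exists>es. path_from_to H (fst m y) es (fst m x)}"

definition path_extension ::
  "'s signature \<Rightarrow> ('s + path_gen) hypergraph \<Rightarrow> (nat \<times> nat) set
     \<Rightarrow> ('s + path_gen) hypergraph \<Rightarrow> mor \<Rightarrow> bool" where
  "path_extension \<Sigma> G R P p \<longleftrightarrow> ma_hypergraph (ext_sig \<Sigma>) P \<and> hom G P p \<and> mono_mor G p \<and>
     (\<forall>e \<in> edges P - snd p ` edges G. lab P e \<in> range Inr) \<and>
     (\<forall>y\<in>outputs G. \<forall>x\<in>inputs G.
        (\<exists>es. path_from_to P (fst p y) es (fst p x)) \<longleftrightarrow> (y, x) \<in> R)"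

definition convex_path_relation ::
  "'l signature \<Rightarrow> 'l hypergraph \<Rightarrow> 'l hypergraph \<Rightarrow> 'l hypergraph \<Rightarrow> mor \<Rightarrow> mor
     \<Rightarrow> (nat \<times> nat) set \<Rightarrow> bool" where
  "convex_path_relation S L\<^sub>1 L\<^sub>2 G f\<^sub>1 f\<^sub>2 R \<longleftrightarrow>
     R \<subseteq> outputs G \<times> inputs G \<and>
     (\<exists>H m. ma_hypergraph S H \<and> hom G H m \<and> mono_mor G m \<and> path_relation G H m = R \<and>
        convex_match L\<^sub>1 H (m \<odot> f\<^sub>1) \<and> convex_match L\<^sub>2 H (m \<odot> f\<^sub>2))"

definition maximal_path_relation ::
  "'l signature \<Rightarrow> 'l hypergraph \<Rightarrow> 'l hypergraph \<Rightarrow> 'l hypergraph \<Rightarrow> mor \<Rightarrow> mor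
     \<Rightarrow> (nat \<times> nat) set \<Rightarrow> bool" where
  "maximal_path_relation S L\<^sub>1 L\<^sub>2 G f\<^sub>1 f\<^sub>2 R \<longleftrightarrow>
     convex_path_relation S L\<^sub>1 L\<^sub>2 G f\<^sub>1 f\<^sub>2 R \<and>
     (\<nexists>R'. convex_path_relation S L\<^sub>1 L\<^sub>2 G f\<^sub>1 f\<^sub>2 R' \<and> R \<subset> R')"

text \<open>
  The context of \<open>t'\<close> (with codomain \<open>P\<close>) arises from that of \<open>t\<close> (with codomain \<open>G\<close>) by a pushout
  square over \<open>p : G \<rightarrow> P\<close>, and the gluing maps of the rule agree along it.
\<close>

definition context_along ::
  "'l signature \<Rightarrow> 'l rule \<Rightarrow> 'l hypergraph \<Rightarrow> 'l hypergraph \<Rightarrow> mor \<Rightarrow> 'l dpo_data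
     \<Rightarrow> 'l dpo_data \<Rightarrow> bool" where
  "context_along S r G P p t t' \<longleftrightarrow>
     (\<exists>q. pushout S (ctxt t) G (ctxt t') P (ctxt_left t) q p (ctxt_left t') \<and>
        mor_eq (disc (rule_i r + rule_j r) :: 'l hypergraph)
          (ctxt_rule r t') (q \<odot> ctxt_rule r t))"

text \<open>
  The step \<open>t\<close> from \<open>X\<close>, performed by convex rewriting at the match composed with \<open>p\<close>.  Convex
  rewriting fixes the new context up to isomorphism as the boundary complement of the match.
  It is a pushout of the old context along \<open>p\<close> if the old context is a boundary complement (for
  suitable interface maps), but not in general: an identity-wire rule also has a pushout
  complement that closes the wire into a loop, and no convex step has a context extending it.
\<close>

definition performed_along ::
  "'l signature \<Rightarrow> 'l rule \<Rightarrow> mor \<Rightarrow> 'l ihypergraph \<Rightarrow> 'l dpo_data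
     \<Rightarrow> 'l ihypergraph \<Rightarrow> 'l ihypergraph \<Rightarrow> 'l dpo_data \<Rightarrow> bool" where
  "performed_along S r p X t X' Y' t' \<longleftrightarrow>
     convex_step_by S r X' Y' t' \<and>
     mor_eq (lhs r) (mtch t') (p \<odot> mtch t) \<and>
     ((\<exists>d\<^sub>1 d\<^sub>2. boundary_complement S r X (t\<lparr>ctxt_dom := d\<^sub>1, ctxt_cod := d\<^sub>2\<rparr>)) \<longrightarrow>
        context_along S r (carrier X) (carrier X') p t t')"

definition path_joinable ::
  "'s signature \<Rightarrow> ('s + path_gen) rule set \<Rightarrow> ('s + path_gen) rule \<Rightarrow> ('s + path_gen) rule
     \<Rightarrow> ('s + path_gen) ihypergraph \<Rightarrow> ('s + path_gen) dpo_data \<Rightarrow> ('s + path_gen) dpo_data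
     \<Rightarrow> bool" where
  "path_joinable \<Sigma> \<R> r\<^sub>1 r\<^sub>2 X t\<^sub>1 t\<^sub>2 \<longleftrightarrow>
     (\<forall>R. maximal_path_relation (ext_sig \<Sigma>) (lhs r\<^sub>1) (lhs r\<^sub>2) (carrier X) (mtch t\<^sub>1) (mtch t\<^sub>2) R \<longrightarrow>
        (\<exists>P p. path_extension \<Sigma> (carrier X) R (carrier P) p \<and>
           path_relation (carrier X) (carrier P) p = R \<and>
           (\<exists>Y\<^sub>1 Y\<^sub>2 u\<^sub>1 u\<^sub>2.
              performed_along (ext_sig \<Sigma>) r\<^sub>1 p X t\<^sub>1 P Y\<^sub>1 u\<^sub>1 \<and>
              performed_along (ext_sig \<Sigma>) r\<^sub>2 p X t\<^sub>2 P Y\<^sub>2 u\<^sub>2 \<and>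
              convex_joinable (ext_sig \<Sigma>) \<R> Y\<^sub>1 Y\<^sub>2)))"

end

theory Submission
  imports Defs "HOL-Library.Countable"
begin

text \<open>
  Let \<open>R\<close> be the path relation of \<open>m : G \<rightarrow> H\<close>.  Attach to \<open>G\<close> a chain of forks at every output and a
  chain of joins at every input that occur in \<open>R\<close>, and link the chains along \<open>R\<close>.  Sending the new
  nodes to the outputs and inputs they hang on shows that paths in this extension shadow
  paths in \<open>H\<close>, so it is acyclic, has path relation \<open>R\<close>, and matches that are convex in \<open>H\<close>
  are convex in it.

  A convex match in an ma-hypergraph with interface always admits a convex step: cut the match
  out, splitting every boundary node into its incoming and its outgoing side, and glue in the
  right-hand side.  Convexity excludes context paths from the outputs of the match back to its
  inputs, so no cycle arises.  Boundary complements are unique, hence the context of a step of the critical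
  pair that is a boundary complement maps into the new context, and the required square is
  a pushout by cancellation.  Local confluence applied to the extension joins the branching.
\<close>

section \<open>Paths and degrees\<close>

text \<open>The realising \<open>H\<close> cannot itself be the extension: it may add edges labelled
  in the original signature, while a path extension adds path generators only. What is kept of
  \<open>H\<close> is its reachability. The degree bounds dictate the shape of the replacement: an
  output related to several inputs has room for one outgoing edge, so branching has to be spread
  over forks, and dually over joins. Comparing the extension with \<open>H\<close> gives no
  morphism, since a chain of forks collapses to one node; hence heights separate nodes with the same
  anchor.

  The delicate point of the rewriting half is a match node that is both an input and an output of
  the left-hand side. It occurs twice in the context, so the map out of the context need not be
  mono. It is still injective on the nodes that can be sources, and on those that can be targets;
  this one-sided injectivity carries the arguments about degrees and about comparing contexts.

  Lists of edges are awkward to transport along maps; \<open>arcs\<close> replaces them by closures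
  of a relation on nodes.\<close>

definition arcs :: "'l hypergraph \<Rightarrow> (nat \<times> nat) set" where
  "arcs G = {(s, t). \<exists>e\<in>edges G. s \<in> set (src G e) \<and> t \<in> set (tgt G e)}"

lemma arcsI: "e \<in> edges G \<Longrightarrow> s \<in> set (src G e) \<Longrightarrow> t \<in> set (tgt G e) \<Longrightarrow> (s, t) \<in> arcs G"
  unfolding arcs_def by blast

lemma path_Cons:
  "path G (e # es) \<longleftrightarrow> e \<in> edges G \<and>
     (es = [] \<or> path G es \<and> set (tgt G e) \<inter> set (src G (hd es)) \<noteq> {})"
proof (cases es)
  case Nil
  then show ?thesis by (simp add: path_def)
next
  case (Cons e' es')
  have "(\<forall>k. Suc k < length (e # es) \<longrightarrow> P k) \<longleftrightarrow> P 0 \<and> (\<forall>k. Suc k < length es \<longrightarrow> P (Suc k))" for P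
    using Cons by (auto simp: less_Suc_eq_0_disj)
  then show ?thesis unfolding path_def using Cons by auto
qed

lemma path_from_to_trancl:
  assumes "path_from_to G v es w"
  shows "(v, w) \<in> (arcs G)\<^sup>+"
  using assms
proof (induction es arbitrary: v)
  case Nil
  then show ?case by (simp add: path_from_to_def path_def)
next
  case (Cons e es)
  show ?case
  proof (cases "es = []")
    case True
    with Cons.prems show ?thesis
      by (auto simp: path_from_to_def path_Cons intro: arcsI)
  next
    case False
    with Cons.prems obtain u where u: "u \<in> set (tgt G e)" "u \<in> set (src G (hd es))"
      and "path G es" "e \<in> edges G" "v \<in> set (src G e)" "w \<in> set (tgt G (last es))"
      by (auto simp: path_from_to_def path_Cons)
    then have "(v, u) \<in> arcs G" "path_from_to G u es w"
      by (auto simp: path_from_to_def intro: arcsI)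
    with Cons.IH show ?thesis by (meson trancl_into_trancl2)
  qed
qed

text \<open>Cutting the path before and after \<open>e\<close> leaves two stretches that may be
  empty, hence the reflexive closures. Together with \<open>path_from_to_through\<close> this trades
  membership in a path for reachability.\<close>

lemma path_from_to_edge:
  assumes "path_from_to G v es w" and "e \<in> set es"
  shows "\<exists>s\<in>set (src G e). \<exists>t\<in>set (tgt G e). (v, s) \<in> (arcs G)\<^sup>* \<and> (t, w) \<in> (arcs G)\<^sup>*"
  using assms
proof (induction es arbitrary: v)
  case Nil
  then show ?case by simp
next
  case (Cons d es)
  show ?case
  proof (cases "es = []")
    case True
    with Cons.prems show ?thesis by (auto simp: path_from_to_def)
  next
    case False
    with Cons.prems(1) obtain u where u: "u \<in> set (tgt G d)" "u \<in> set (src G (hd es))"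
      and d: "path G es" "d \<in> edges G" "v \<in> set (src G d)" "w \<in> set (tgt G (last es))"
      by (auto simp: path_from_to_def path_Cons)
    then have vu: "(v, u) \<in> arcs G" and uw: "path_from_to G u es w"
      by (auto simp: path_from_to_def intro: arcsI)
    show ?thesis
    proof (cases "e = d")
      case True
      with d u path_from_to_trancl[OF uw] show ?thesis
          by (meson rtrancl.rtrancl_refl trancl_into_rtrancl)
    next
      case False
      with Cons.prems(2) Cons.IH[OF uw] vu show ?thesis
        by (meson converse_rtrancl_into_rtrancl set_ConsD)
    qed
  qed
qed

text \<open>The first edge is prescribed because an empty stretch of arcs is not a path:
  \<open>e\<close> keeps the list nonempty in the base case.\<close>

lemma path_from_to_exists:
  assumes "(t, w) \<in> (arcs G)\<^sup>*" and "e \<in> edges G" and "v \<in> set (src G e)" and "t \<in> set (tgt G e)"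
  shows "\<exists>es. path_from_to G v (e # es) w"
  using assms
proof (induction arbitrary: e v rule: converse_rtrancl_induct)
  case base
  then have "path_from_to G v [e] w" by (simp add: path_from_to_def path_Cons)
  then show ?case by blast
next
  case (step t u)
  then obtain d where d: "d \<in> edges G" "t \<in> set (src G d)" "u \<in> set (tgt G d)"
    unfolding arcs_def by blast
  with step.IH obtain es where "path_from_to G t (d # es) w" by blast
  with d step.prems have "path_from_to G v (e # d # es) w"
    by (auto simp: path_from_to_def path_Cons[of G e])
  then show ?case by blast
qed

lemma path_from_to_through:
  assumes "(v, s) \<in> (arcs G)\<^sup>*" and "(t, w) \<in> (arcs G)\<^sup>*" and "e \<in> edges G"
    and "s \<in> set (src G e)" and "t \<in> set (tgt G e)"
  shows "\<exists>es. path_from_to G v es w \<and> e \<in> set es"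
  using assms(1)
proof (induction rule: converse_rtrancl_induct)
  case base
  from path_from_to_exists[OF assms(2-5)] show ?case by (meson list.set_intros(1))
next
  case (step v u)
  then obtain es where es: "path_from_to G u es w" "e \<in> set es" by blast
  from step obtain d where d: "d \<in> edges G" "v \<in> set (src G d)" "u \<in> set (tgt G d)"
    unfolding arcs_def by blast
  have "es \<noteq> []" using es by auto
  with es d have "path_from_to G v (d # es) w"
    by (auto simp: path_from_to_def path_Cons)
  with es show ?case by (meson list.set_intros(2))
qed

lemma path_from_to_iff: "(\<exists>es. path_from_to G v es w) \<longleftrightarrow> (v, w) \<in> (arcs G)\<^sup>+"
proof
  assume "(v, w) \<in> (arcs G)\<^sup>+"
  then obtain u where "(v, u) \<in> arcs G" and uw: "(u, w) \<in> (arcs G)\<^sup>*" by (meson tranclD)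
  then obtain e where "e \<in> edges G" "v \<in> set (src G e)" "u \<in> set (tgt G e)"
    unfolding arcs_def by blast
  from path_from_to_exists[OF uw this] show "\<exists>es. path_from_to G v es w" by blast
qed (auto dest: path_from_to_trancl)

text \<open>A cycle is a path from a node back to itself, the node being shared by the targets of
  the last edge and the sources of the first.\<close>

lemma no_cycle_iff: "(\<nexists>es. cycle G es) \<longleftrightarrow> acyclic (arcs G)"
proof -
  have "cycle G es \<longleftrightarrow> (\<exists>v. path_from_to G v es v)" for es
    unfolding cycle_def path_from_to_def by blast
  then show ?thesis unfolding acyclic_def using path_from_to_iff by blast
qed

text \<open>Convexity becomes a condition on single edges and reachability, so it can be checked
  through any comparison of reachability relations.\<close>

lemma convex_match_iff:
  "convex_match L G f \<longleftrightarrow> hom L G f \<and> mono_mor L f \<and>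
     (\<forall>v\<in>fst f ` nodes L. \<forall>w\<in>fst f ` nodes L. \<forall>e\<in>edges G. \<forall>s\<in>set (src G e). \<forall>t\<in>set (tgt G e).
        (v, s) \<in> (arcs G)\<^sup>* \<longrightarrow> (t, w) \<in> (arcs G)\<^sup>* \<longrightarrow> e \<in> snd f ` edges L)"
    (is "_ \<longleftrightarrow> _ \<and> _ \<and> ?edges")
proof -
  have "?edges \<longleftrightarrow> (\<forall>v\<in>fst f ` nodes L. \<forall>w\<in>fst f ` nodes L. \<forall>es.
        path_from_to G v es w \<longrightarrow> set es \<subseteq> snd f ` edges L)" (is "_ \<longleftrightarrow> ?paths")
  proof
    assume *: ?edges
    show ?paths
    proof (intro ballI allI impI subsetI)
      fix v w es e
      assume vw: "v \<in> fst f ` nodes L" "w \<in> fst f ` nodes L"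
        and es: "path_from_to G v es w" "e \<in> set es"
      then have "e \<in> edges G" by (auto simp: path_from_to_def path_def)
      with * vw path_from_to_edge[OF es] show "e \<in> snd f ` edges L" by meson
    qed
  next
    assume "?paths"
    show ?edges
    proof (intro ballI impI)
      fix v w e s t
      assume vw: "v \<in> fst f ` nodes L" "w \<in> fst f ` nodes L" and e: "e \<in> edges G"
        "s \<in> set (src G e)" "t \<in> set (tgt G e)" "(v, s) \<in> (arcs G)\<^sup>*" "(t, w) \<in> (arcs G)\<^sup>*"
      then obtain es where "path_from_to G v es w" "e \<in> set es"
        using path_from_to_through by blast
      with \<open>?paths\<close> vw show "e \<in> snd f ` edges L" by blast
    qed
  qed
  then show ?thesis unfolding convex_match_def by blast
qed

section \<open>Degree bounds as disjointness of ends\<close>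

definition ends :: "nat set \<Rightarrow> (nat \<Rightarrow> nat list) \<Rightarrow> nat set" where
  "ends E s = (\<Union>e\<in>E. set (s e))"

text \<open>The degree bounds without cardinalities: an incidence is an edge with a position, and a
  node of degree two or more is a failure of injectivity. The incidence function is a parameter, so
  each fact serves sources and targets alike.\<close>

definition disjoint_ends :: "nat set \<Rightarrow> (nat \<Rightarrow> nat list) \<Rightarrow> bool" where
  "disjoint_ends E s \<longleftrightarrow> inj_on (\<lambda>(e, k). s e ! k) {(e, k). e \<in> E \<and> k < length (s e)}"

abbreviation "sources G \<equiv> ends (edges G) (src G)"
abbreviation "targets G \<equiv> ends (edges G) (tgt G)"

lemma disjoint_endsI:
  assumes "\<And>e k e' k'. e \<in> E \<Longrightarrow> e' \<in> E \<Longrightarrow> k < length (s e) \<Longrightarrow> k' < length (s e') \<Longrightarrow>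
    s e ! k = s e' ! k' \<Longrightarrow> e = e' \<and> k = k'"
  shows "disjoint_ends E s"
  using assms unfolding disjoint_ends_def inj_on_def by auto

lemma disjoint_endsD:
  assumes "disjoint_ends E s" "e \<in> E" "e' \<in> E" "k < length (s e)" "k' < length (s e')"
    "s e ! k = s e' ! k'"
  shows "e = e'" "k = k'"
  using inj_onD[OF assms(1)[unfolded disjoint_ends_def], of "(e, k)" "(e', k')"] assms by auto

lemma disjoint_endsD_set:
  assumes "disjoint_ends E s" "e \<in> E" "e' \<in> E" "v \<in> set (s e)" "v \<in> set (s e')"
  shows "e = e'"
  using assms by (metis disjoint_endsD(1) in_set_conv_nth)

lemma finite_incidences:
  fixes s :: "nat \<Rightarrow> nat list"
  assumes "finite E"
  shows "finite {(e, k). e \<in> E \<and> k < length (s e)}"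
proof -
  have "{(e, k). e \<in> E \<and> k < length (s e)} = (SIGMA e:E. {..<length (s e)})" by auto
  with assms show ?thesis by simp
qed

lemma finite_incidences_at:
  fixes s :: "nat \<Rightarrow> nat list"
  assumes "finite E"
  shows "finite {(e, k). e \<in> E \<and> k < length (s e) \<and> s e ! k = v}"
  by (rule finite_subset[OF _ finite_incidences[OF assms, of s]]) auto

lemma degree_eq_0_iff:
  assumes "finite E"
  shows "card {(e, k). e \<in> E \<and> k < length (s e) \<and> s e ! k = v} = 0 \<longleftrightarrow> v \<notin> ends E s"
  unfolding card_eq_0_iff using finite_incidences_at[OF assms, of s v]
  by (auto simp: ends_def in_set_conv_nth)

lemma degree_le_1_iff:
  assumes "finite E" and "ends E s \<subseteq> N"
  shows "(\<forall>v\<in>N. card {(e, k). e \<in> E \<and> k < length (s e) \<and> s e ! k = v} \<le> 1) \<longleftrightarrow> disjoint_ends E s"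
    (is "?l \<longleftrightarrow> ?r")
proof
  assume *: ?l
  show ?r
  proof (rule disjoint_endsI)
    fix e k e' k'
    assume a: "e \<in> E" "e' \<in> E" "k < length (s e)" "k' < length (s e')" "s e ! k = s e' ! k'"
    let ?I = "{(d, l). d \<in> E \<and> l < length (s d) \<and> s d ! l = s e ! k}"
    have "s e ! k \<in> ends E s" using a nth_mem unfolding ends_def by blast
    then have "s e ! k \<in> N" using assms by blast
    with * have "card ?I \<le> Suc 0" by simp
    moreover have "(e, k) \<in> ?I" "(e', k') \<in> ?I" using a by auto
    ultimately have "(e, k) = (e', k')"
      using card_le_Suc0_iff_eq[OF finite_incidences_at[OF assms(1), of s "s e ! k"]] by blast
    then show "e = e' \<and> k = k'" by simp
  qed
next
  assume *: ?r
  show ?l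
  proof
    fix v
    let ?I = "{(e, k). e \<in> E \<and> k < length (s e) \<and> s e ! k = v}"
    have "x = y" if "x \<in> ?I" "y \<in> ?I" for x y
      by (rule inj_onD[OF *[unfolded disjoint_ends_def]]) (use that in \<open>auto split: prod.splits\<close>)
    then show "card ?I \<le> 1"
      using card_le_Suc0_iff_eq[OF finite_incidences_at[OF assms(1), of s v]] by simp
  qed
qed

lemma hypergraph_ends:
  assumes "hypergraph S G"
  shows "sources G \<subseteq> nodes G" "targets G \<subseteq> nodes G" "finite (nodes G)" "finite (edges G)"
  using assms by (auto simp: hypergraph_def ends_def)

lemma ma_hypergraph_iff:
  "ma_hypergraph S G \<longleftrightarrow> hypergraph S G \<and> acyclic (arcs G) \<and>
     disjoint_ends (edges G) (src G) \<and> disjoint_ends (edges G) (tgt G)"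
proof (cases "hypergraph S G")
  case True
  note G = hypergraph_ends[OF True]
  show ?thesis
    unfolding ma_hypergraph_def no_cycle_iff in_degree_def out_degree_def
      degree_le_1_iff[OF G(4) G(1), symmetric] degree_le_1_iff[OF G(4) G(2), symmetric]
    by blast
qed (simp add: ma_hypergraph_def)

lemma inputs_eq: "hypergraph S G \<Longrightarrow> inputs G = nodes G - targets G"
  unfolding inputs_def in_degree_def by (auto simp: degree_eq_0_iff hypergraph_def)

lemma outputs_eq: "hypergraph S G \<Longrightarrow> outputs G = nodes G - sources G"
  unfolding outputs_def out_degree_def by (auto simp: degree_eq_0_iff hypergraph_def)

section \<open>Discrete hypergraphs, copairings and morphisms\<close>

lemma hypergraph_disc: "hypergraph S (disc n)"
  by (simp add: hypergraph_def disc_def)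

lemma nodes_disc [simp]: "nodes (disc n) = {..<n}" and edges_disc [simp]: "edges (disc n) = {}"
  by (simp_all add: disc_def)

lemma hom_disc_iff: "hom (disc n) G f \<longleftrightarrow> (\<forall>a<n. fst f a \<in> nodes G)"
  by (auto simp: hom_def)

lemma mono_mor_disc_iff: "mono_mor (disc n) f \<longleftrightarrow> inj_on (fst f) {..<n}"
  by (simp add: mono_mor_def)

lemma mor_eq_disc_iff: "mor_eq (disc n) f g \<longleftrightarrow> (\<forall>a<n. fst f a = fst g a)"
  by (auto simp: mor_eq_def)

lemma fst_copair: "fst (copair n f g) k = (if k < n then fst f k else fst g (k - n))"
  by (simp add: copair_def)

lemma fst_mor_comp [simp]: "fst (g \<odot> f) v = fst g (fst f v)"
  and snd_mor_comp [simp]: "snd (g \<odot> f) e = snd g (snd f e)"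
  by (simp_all add: mor_comp_def)

lemma lessThan_add: "{..<n + m} = {..<n} \<union> (\<lambda>k. n + k) ` {..<m}" for n m :: nat
proof -
  have "k < n \<or> (\<exists>l<m. k = n + l)" if "k < n + m" for k using that by presburger
  then show ?thesis by auto
qed

lemma copair_image_parts:
  "fst (copair n f g) ` {..<n} = fst f ` {..<n}"
  "fst (copair n f g) ` (\<lambda>k. n + k) ` {..<m} = fst g ` {..<m}"
proof -
  show "fst (copair n f g) ` {..<n} = fst f ` {..<n}"
    by (rule image_cong) (simp_all add: fst_copair)
  show "fst (copair n f g) ` (\<lambda>k. n + k) ` {..<m} = fst g ` {..<m}"
    unfolding image_image by (rule image_cong) (simp_all add: fst_copair)
qed

lemma copair_image: "fst (copair n f g) ` {..<n + m} = fst f ` {..<n} \<union> fst g ` {..<m}"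
  unfolding lessThan_add image_Un copair_image_parts by (rule refl)

lemma copair_inj_iff:
  "inj_on (fst (copair n f g)) {..<n + m} \<longleftrightarrow>
     inj_on (fst f) {..<n} \<and> inj_on (fst g) {..<m} \<and> fst f ` {..<n} \<inter> fst g ` {..<m} = {}"
proof -
  have "inj_on (fst (copair n f g)) {..<n} \<longleftrightarrow> inj_on (fst f) {..<n}"
    by (rule inj_on_cong) (simp add: fst_copair)
  moreover have "inj_on (fst (copair n f g)) ((\<lambda>k. n + k) ` {..<m}) \<longleftrightarrow> inj_on (fst g) {..<m}"
    by (auto simp: inj_on_def fst_copair)
  moreover have "{..<n} - (\<lambda>k. n + k) ` {..<m} = {..<n}"
    "(\<lambda>k. n + k) ` {..<m} - {..<n} = (\<lambda>k. n + k) ` {..<m}"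
    by auto
  ultimately show ?thesis
    unfolding lessThan_add inj_on_Un copair_image_parts by (simp only: copair_image_parts)
qed

lemma homD:
  assumes "hom G H f"
  shows "v \<in> nodes G \<Longrightarrow> fst f v \<in> nodes H" "e \<in> edges G \<Longrightarrow> snd f e \<in> edges H"
    "e \<in> edges G \<Longrightarrow> lab H (snd f e) = lab G e"
    "e \<in> edges G \<Longrightarrow> src H (snd f e) = map (fst f) (src G e)"
    "e \<in> edges G \<Longrightarrow> tgt H (snd f e) = map (fst f) (tgt G e)"
  using assms by (auto simp: hom_def)

lemma hom_comp: "hom G H f \<Longrightarrow> hom H K g \<Longrightarrow> hom G K (g \<odot> f)"
  by (auto simp: hom_def mor_comp_def image_subset_iff)

lemma hom_arcs: "hom G H f \<Longrightarrow> (s, t) \<in> arcs G \<Longrightarrow> (fst f s, fst f t) \<in> arcs H"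
  unfolding arcs_def by (force simp: hom_def image_subset_iff)

lemma hom_arcs_rtrancl:
  assumes "hom G H f" "(s, t) \<in> (arcs G)\<^sup>*"
  shows "(fst f s, fst f t) \<in> (arcs H)\<^sup>*"
  using assms(2) by (induction) (auto dest: hom_arcs[OF assms(1)])

lemma hom_arcs_trancl:
  assumes "hom G H f" "(s, t) \<in> (arcs G)\<^sup>+"
  shows "(fst f s, fst f t) \<in> (arcs H)\<^sup>+"
  using assms(2) by (induction) (auto dest: hom_arcs[OF assms(1)] intro: trancl.intros)

lemma hom_acyclic: "hom G H f \<Longrightarrow> acyclic (arcs H) \<Longrightarrow> acyclic (arcs G)"
  unfolding acyclic_def using hom_arcs_trancl by blast

text \<open>A collision of incidences survives every node map, so injectivity is asked of the edge
  map alone. This suits a context, whose boundary nodes may be merged when it is mapped to the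
  host.\<close>

lemma disjoint_ends_reflect:
  assumes "disjoint_ends E' s'" and "inj_on j E" "j ` E \<subseteq> E'"
    and "\<And>e. e \<in> E \<Longrightarrow> s' (j e) = map k (s e)"
  shows "disjoint_ends E s"
proof (rule disjoint_endsI)
  fix e l e' l'
  assume a: "e \<in> E" "e' \<in> E" "l < length (s e)" "l' < length (s e')" "s e ! l = s e' ! l'"
  then have "s' (j e) ! l = s' (j e') ! l'" using assms(4) by simp
  moreover have "j e \<in> E'" "j e' \<in> E'" "l < length (s' (j e))" "l' < length (s' (j e'))"
    using a assms by auto
  ultimately have "j e = j e'" "l = l'" using disjoint_endsD[OF assms(1)] by blast+
  then show "e = e' \<and> l = l'" using assms(2) a by (simp add: inj_on_eq_iff)
qed

text \<open>The rank counts the nodes strictly below a node. The bound \<open>K\<close> allows the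
  ranks of several pieces to be stacked on top of each other.\<close>

lemma acyclic_arcs_bounded_rank:
  assumes "hypergraph S G" and "acyclic (arcs G)"
  obtains \<rho> :: "nat \<Rightarrow> nat" and K where "arcs G \<subseteq> measure \<rho>" "\<forall>v. \<rho> v < K"
proof
  let ?below = "\<lambda>v. {w \<in> nodes G. (w, v) \<in> (arcs G)\<^sup>+}"
  have fin: "finite (?below v)" for v using hypergraph_ends[OF assms(1)] by simp
  show "\<forall>v. card (?below v) < Suc (card (nodes G))"
    using hypergraph_ends[OF assms(1)] by (auto intro: card_mono simp: less_Suc_eq_le)
  have "card (?below s) < card (?below t)" if st: "(s, t) \<in> arcs G" for s t
  proof -
    have "s \<in> nodes G" using st hypergraph_ends(1)[OF assms(1)] by (auto simp: arcs_def ends_def)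
    then have "s \<in> ?below t" "s \<notin> ?below s" using st assms(2) by (auto simp: acyclic_def)
    moreover have "?below s \<subseteq> ?below t" using st by (auto intro: trancl_into_trancl)
    ultimately show ?thesis by (intro psubset_card_mono fin) blast
  qed
  then show "arcs G \<subseteq> measure (\<lambda>v. card (?below v))" by auto
qed

lemma acyclic_arcsI:
  fixes \<rho> :: "nat \<Rightarrow> nat"
  assumes "\<And>s t. (s, t) \<in> arcs G \<Longrightarrow> \<rho> s < \<rho> t"
  shows "acyclic (arcs G)"
proof -
  have "arcs G \<subseteq> measure \<rho>" using assms by auto
  then show ?thesis by (meson acyclic_subset wf_acyclic wf_measure)
qed

section \<open>Pushouts over discrete hypergraphs\<close>

text \<open>The explicit form of a pushout along an injective \<open>g\<close>: \<open>B\<close>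
  enters unchanged, and \<open>C\<close> adds its edges and its nodes off the boundary.
  \<open>k\<close> may merge boundary nodes because \<open>f\<close> may: the two legs of a rule
  meet in an identity wire.\<close>

definition gluing ::
  "nat \<Rightarrow> 'l hypergraph \<Rightarrow> 'l hypergraph \<Rightarrow> 'l hypergraph \<Rightarrow> mor \<Rightarrow> mor \<Rightarrow> mor \<Rightarrow> mor \<Rightarrow> bool" where
  "gluing n B C D f g h k \<longleftrightarrow>
     hom B D h \<and> hom C D k \<and> (\<forall>a<n. fst h (fst f a) = fst k (fst g a)) \<and> mono_mor B h \<and>
     inj_on (fst k) (nodes C - fst g ` {..<n}) \<and> inj_on (snd k) (edges C) \<and>
     nodes D = fst h ` nodes B \<union> fst k ` (nodes C - fst g ` {..<n}) \<and>
     fst h ` nodes B \<inter> fst k ` (nodes C - fst g ` {..<n}) = {} \<and>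
     edges D = snd h ` edges B \<union> snd k ` edges C \<and>
     snd h ` edges B \<inter> snd k ` edges C = {}"

lemma gluing_pushout:
  assumes B: "hypergraph S B" and C: "hypergraph S C" and D: "hypergraph S D"
    and f: "hom (disc n) B f" and g: "hom (disc n) C g" and gl: "gluing n B C D f g h k"
  shows "pushout S (disc n) B C D f g h k"
proof -
  let ?N = "nodes C - fst g ` {..<n}"
  have h: "hom B D h" and k: "hom C D k" and comm: "\<And>a. a < n \<Longrightarrow> fst h (fst f a) = fst k (fst g a)"
    and injn: "inj_on (fst h) (nodes B)" and inje: "inj_on (snd h) (edges B)"
    and kn: "inj_on (fst k) ?N" and ke: "inj_on (snd k) (edges C)"
    and nD: "nodes D = fst h ` nodes B \<union> fst k ` ?N" and nd: "fst h ` nodes B \<inter> fst k ` ?N = {}"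
    and eD: "edges D = snd h ` edges B \<union> snd k ` edges C"
    and ed: "snd h ` edges B \<inter> snd k ` edges C = {}"
    using gl by (auto simp: gluing_def mono_mor_def)
  have univ: "\<exists>w. hom D X w \<and> mor_eq B (w \<odot> h) u \<and> mor_eq C (w \<odot> k) v \<and>
           (\<forall>w'. hom D X w' \<and> mor_eq B (w' \<odot> h) u \<and> mor_eq C (w' \<odot> k) v \<longrightarrow> mor_eq D w' w)"
    if u: "hom B X u" and v: "hom C X v"
        and uv: "mor_eq (disc n :: 'a hypergraph) (u \<odot> f) (v \<odot> g)" for X u v
  proof -
    \<comment> \<open>Every node of \<open>D\<close> comes from exactly one node of \<open>B\<close>
      or one node of \<open>C\<close> off the boundary, so the mediating map inverts
      \<open>h\<close> on the former and the restricted \<open>k\<close> on the latter.\<close>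
    define wn where "wn y = (if y \<in> fst h ` nodes B then fst u (inv_into (nodes B) (fst h) y)
        else fst v (inv_into ?N (fst k) y))" for y
    define we where "we y = (if y \<in> snd h ` edges B then snd u (inv_into (edges B) (snd h) y)
        else snd v (inv_into (edges C) (snd k) y))" for y
    have wnB: "wn (fst h b) = fst u b" if "b \<in> nodes B" for b
      using that injn by (simp add: wn_def)
    have wnC: "wn (fst k c) = fst v c" if c: "c \<in> nodes C" for c
    proof (cases "c \<in> ?N")
      case True
      then have "fst k c \<notin> fst h ` nodes B" using nd by blast
      with True kn show ?thesis unfolding wn_def by (simp only: if_False inv_into_f_f)
    next
      \<comment> \<open>A boundary node of \<open>C\<close> is evaluated through \<open>B\<close>;
        the squares of \<open>(h, k)\<close> and of \<open>(u, v)\<close> both commute over its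
        preimage.\<close>
      case False
      with c obtain a where a: "a < n" "c = fst g a" by auto
      then have "fst f a \<in> nodes B" using f by (simp add: hom_disc_iff)
      then have "wn (fst k c) = fst u (fst f a)" using wnB a comm by metis
      also have "\<dots> = fst v c" using uv a by (simp add: mor_eq_disc_iff)
      finally show ?thesis .
    qed
    have weB: "we (snd h b) = snd u b" if "b \<in> edges B" for b
      using that inje by (simp add: we_def)
    have weC: "we (snd k c) = snd v c" if c: "c \<in> edges C" for c
    proof -
      have "snd k c \<notin> snd h ` edges B" using ed c by blast
      then show ?thesis unfolding we_def using ke c by simp
    qed
    have setB: "set (src B e) \<subseteq> nodes B" "set (tgt B e) \<subseteq> nodes B" if "e \<in> edges B" for e
      using B that by (auto simp: hypergraph_def)
    have setC: "set (src C e) \<subseteq> nodes C" "set (tgt C e) \<subseteq> nodes C" if "e \<in> edges C" for e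
      using C that by (auto simp: hypergraph_def)
    have "hom D X (wn, we)"
      unfolding hom_def
    proof (intro conjI ballI)
      show "fst (wn, we) ` nodes D \<subseteq> nodes X"
        using wnB wnC homD(1)[OF u] homD(1)[OF v] unfolding nD by auto
      show "snd (wn, we) ` edges D \<subseteq> edges X"
        using weB weC homD(2)[OF u] homD(2)[OF v] unfolding eD by auto
      fix e assume "e \<in> edges D"
      then consider b where "b \<in> edges B" "e = snd h b" | c where "c \<in> edges C" "e = snd k c"
        unfolding eD by blast
      then have "lab X (we e) = lab D e \<and> src X (we e) = map wn (src D e) \<and> tgt X (we e) =
          map wn (tgt D e)"
      proof cases
        case 1
        then show ?thesis using homD(3-5)[OF h, of b] homD(3-5)[OF u, of b] weB wnB setB[of b]
          by auto
      next
        case 2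
        then show ?thesis using homD(3-5)[OF k, of c] homD(3-5)[OF v, of c] weC wnC setC[of c]
          by auto
      qed
      then show "lab X (snd (wn, we) e) = lab D e"
          "src X (snd (wn, we) e) = map (fst (wn, we)) (src D e)"
        "tgt X (snd (wn, we) e) = map (fst (wn, we)) (tgt D e)" by simp_all
    qed
    moreover have "mor_eq B ((wn, we) \<odot> h) u" "mor_eq C ((wn, we) \<odot> k) v"
      using wnB wnC weB weC by (auto simp: mor_eq_def)
    moreover have "mor_eq D w' (wn, we)"
      if "hom D X w'" "mor_eq B (w' \<odot> h) u" "mor_eq C (w' \<odot> k) v" for w'
      using that wnB wnC weB weC unfolding mor_eq_def nD eD by auto
    ultimately show ?thesis by blast
  qed
  have "mor_eq (disc n :: 'a hypergraph) (h \<odot> f) (k \<odot> g)"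
    using comm by (simp add: mor_eq_disc_iff)
  with B C D f g h k univ show ?thesis
    unfolding pushout_def using hypergraph_disc by blast
qed

lemma gluing_exists:
  assumes B: "hypergraph S B" and C: "hypergraph S C"
    and f: "hom (disc n) B f" and g: "hom (disc n) C g" and inj: "inj_on (fst g) {..<n}"
  obtains D h k where "hypergraph S D" "gluing n B C D f g h k"
proof -
  let ?N = "nodes C - fst g ` {..<n}"
  \<comment> \<open>Even codes hold \<open>B\<close> and odd codes hold what \<open>C\<close> adds;
    a boundary node of \<open>C\<close> takes the even code of the node of \<open>B\<close> it is
    glued to.\<close>
  define kn where "kn c = (if c \<in> fst g ` {..<n} then 2 * fst f (inv_into {..<n} (fst g) c) else 2
      * c + 1)" for c
  define D where "D = \<lparr> nodes = (\<lambda>b. 2 * b) ` nodes B \<union> (\<lambda>c. 2 * c + 1) ` ?N,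
    edges = (\<lambda>b. 2 * b) ` edges B \<union> (\<lambda>c. 2 * c + 1) ` edges C,
    src = (\<lambda>e. if even e then map (\<lambda>b. 2 * b) (src B (e div 2)) else map kn (src C (e div 2))),
    tgt = (\<lambda>e. if even e then map (\<lambda>b. 2 * b) (tgt B (e div 2)) else map kn (tgt C (e div 2))),
    lab = (\<lambda>e. if even e then lab B (e div 2) else lab C (e div 2)) \<rparr>"
  have kg: "kn (fst g a) = 2 * fst f a" if "a < n" for a
    using that inj by (simp add: kn_def)
  have kN: "kn c = 2 * c + 1" if "c \<notin> fst g ` {..<n}" for c
    using that unfolding kn_def by (simp only: if_False)
  have fB: "fst f a \<in> nodes B" if "a < n" for a
    using f that by (simp add: hom_disc_iff)
  have kD: "kn c \<in> nodes D" if "c \<in> nodes C" for c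
  proof (cases "c \<in> fst g ` {..<n}")
    case True
    then obtain a where "a < n" "c = fst g a" by auto
    with kg fB show ?thesis by (simp add: D_def)
  next
    case False
    with kN[OF False] that show ?thesis by (auto simp: D_def)
  qed
  have kim: "kn ` ?N = (\<lambda>c. 2 * c + 1) ` ?N"
    by (rule image_cong) (use kN in auto)
  have "hypergraph S D"
    unfolding hypergraph_def
  proof (intro conjI ballI)
    show "finite (nodes D)" "finite (edges D)"
      using B C by (simp_all add: D_def hypergraph_def)
    fix e assume "e \<in> edges D"
    then consider b where "b \<in> edges B" "e = 2 * b" | c where "c \<in> edges C" "e = 2 * c + 1"
      unfolding D_def by auto
    then have "lab D e \<in> gens S \<and> length (src D e) = arity S (lab D e) \<and> set (src D e) \<subseteq> nodes D \<and>
      length (tgt D e) = coarity S (lab D e) \<and> set (tgt D e) \<subseteq> nodes D"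
    proof cases
      case 1
      then show ?thesis using B by (auto simp: D_def hypergraph_def)
    next
      case 2
      then have "lab D e = lab C c" "src D e = map kn (src C c)" "tgt D e = map kn (tgt C c)"
        by (simp_all add: D_def)
      then show ?thesis using C 2(1) kD unfolding hypergraph_def by fastforce
    qed
    then show "lab D e \<in> gens S" "length (src D e) = arity S (lab D e)" "set (src D e) \<subseteq> nodes D"
      "length (tgt D e) = coarity S (lab D e)" "set (tgt D e) \<subseteq> nodes D" by blast+
  qed
  moreover have "gluing n B C D f g (\<lambda>b. 2 * b, \<lambda>b. 2 * b) (kn, \<lambda>c. 2 * c + 1)"
    unfolding gluing_def
  proof (intro conjI)
    show "hom B D (\<lambda>b. 2 * b, \<lambda>b. 2 * b)" by (auto simp: hom_def D_def)
    show "hom C D (kn, \<lambda>c. 2 * c + 1)" using kD by (auto simp: hom_def D_def)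
    show "\<forall>a<n. fst (\<lambda>b. 2 * b, \<lambda>b. 2 * b) (fst f a) = fst (kn, \<lambda>c. 2 * c + 1) (fst g a)"
      using kg by simp
    show "mono_mor B (\<lambda>b. 2 * b, \<lambda>b. 2 * b)" by (simp add: mono_mor_def inj_on_def)
    show "inj_on (fst (kn, \<lambda>c. 2 * c + 1)) ?N" using kN by (auto simp: inj_on_def)
    show "inj_on (snd (kn, \<lambda>c. 2 * c + 1)) (edges C)" by (simp add: inj_on_def)
    show "nodes D = fst (\<lambda>b. 2 * b, \<lambda>b. 2 * b) ` nodes B \<union> fst (kn, \<lambda>c. 2 * c + 1) ` ?N"
      using kim by (simp add: D_def)
    show "fst (\<lambda>b. 2 * b, \<lambda>b. 2 * b) ` nodes B \<inter> fst (kn, \<lambda>c. 2 * c + 1) ` ?N = {}"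
      unfolding fst_conv kim by (auto, presburger)
    show "edges D = snd (\<lambda>b. 2 * b, \<lambda>b. 2 * b) ` edges B \<union> snd (kn, \<lambda>c. 2 * c + 1) ` edges C"
      by (simp add: D_def)
    show "snd (\<lambda>b. 2 * b, \<lambda>b. 2 * b) ` edges B \<inter> snd (kn, \<lambda>c. 2 * c + 1) ` edges C = {}"
      unfolding snd_conv by (auto, presburger)
  qed
  ultimately show ?thesis using that by blast
qed

text \<open>Any identification made in a pushout is preserved by its mediating morphism into the
  explicit gluing, where the parts are visibly disjoint. This is how information is drawn from the
  steps of a critical pair, which are given by the universal property alone.\<close>

lemma pushout_disjoint:
  assumes po: "pushout S (disc n) B C D f g h k" and inj: "inj_on (fst g) {..<n}"
  shows "c \<in> nodes C - fst g ` {..<n} \<Longrightarrow> fst k c \<notin> fst h ` nodes B"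
    and "e \<in> edges C \<Longrightarrow> snd k e \<notin> snd h ` edges B"
proof -
  have BC: "hypergraph S B" "hypergraph S C" "hom (disc n) B f" "hom (disc n) C g"
    using po by (auto simp: pushout_def)
  obtain D' h' k' where D': "hypergraph S D'" and gl: "gluing n B C D' f g h' k'"
    using gluing_exists[OF BC inj] .
  have "hom B D' h'" "hom C D' k'" "mor_eq (disc n :: 'a hypergraph) (h' \<odot> f) (k' \<odot> g)"
    using gl by (auto simp: gluing_def mor_eq_disc_iff)
  then obtain w where w: "mor_eq B (w \<odot> h) h'" "mor_eq C (w \<odot> k) k'"
    using po D' unfolding pushout_def by meson
  show "fst k c \<notin> fst h ` nodes B" if c: "c \<in> nodes C - fst g ` {..<n}"
  proof
    assume "fst k c \<in> fst h ` nodes B"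
    then obtain b where b: "b \<in> nodes B" "fst k c = fst h b" by blast
    then have "fst k' c = fst h' b" using w c by (force simp: mor_eq_def)
    then show False using gl b c unfolding gluing_def by blast
  qed
  show "snd k e \<notin> snd h ` edges B" if e: "e \<in> edges C"
  proof
    assume "snd k e \<in> snd h ` edges B"
    then obtain b where b: "b \<in> edges B" "snd k e = snd h b" by blast
    then have "snd k' e = snd h' b" using w e by (force simp: mor_eq_def)
    then show False using gl b e unfolding gluing_def by blast
  qed
qed

lemma pushout_cancel:
  assumes left: "pushout S K L C G l c f g" and outer: "pushout S K L C' P l c' (p \<odot> f) g'"
    and p: "hom G P p" and q: "hom C C' q" and cq: "mor_eq K c' (q \<odot> c)"
    and sq: "mor_eq C (p \<odot> g) (g' \<odot> q)"
  shows "pushout S C G C' P g q p g'"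
  unfolding pushout_def
proof (intro conjI allI impI)
  show "hypergraph S C" "hypergraph S G" "hom C G g"
    using left by (simp_all add: pushout_def)
  show "hypergraph S C'" "hypergraph S P" "hom C' P g'"
    using outer by (simp_all add: pushout_def)
  show "hom C C' q" "hom G P p" "mor_eq C (p \<odot> g) (g' \<odot> q)" using p q sq by simp_all
  have f: "hom L G f" and g: "hom C G g" and c: "hom K C c" and l: "hom K L l"
    and fl: "mor_eq K (f \<odot> l) (g \<odot> c)"
    using left by (simp_all add: pushout_def)
  fix X u v
  assume "hypergraph S X \<and> hom G X u \<and> hom C' X v \<and> mor_eq C (u \<odot> g) (v \<odot> q)"
  then have X: "hypergraph S X" and u: "hom G X u" and v: "hom C' X v"
    and uv: "mor_eq C (u \<odot> g) (v \<odot> q)" by simp_all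
  have ufl: "mor_eq K ((u \<odot> f) \<odot> l) (v \<odot> c')"
  proof -
    have "fst u (fst f (fst l a)) = fst v (fst c' a)" if a: "a \<in> nodes K" for a
      using a fl uv cq homD(1)[OF c a] by (auto simp: mor_eq_def)
    moreover have "snd u (snd f (snd l a)) = snd v (snd c' a)" if a: "a \<in> edges K" for a
      using a fl uv cq homD(2)[OF c a] by (auto simp: mor_eq_def)
    ultimately show ?thesis by (simp add: mor_eq_def)
  qed
  then obtain w where w: "hom P X w" "mor_eq L (w \<odot> (p \<odot> f)) (u \<odot> f)" "mor_eq C' (w \<odot> g') v"
    and uniq: "\<And>w'. hom P X w' \<Longrightarrow> mor_eq L (w' \<odot> (p \<odot> f)) (u \<odot> f) \<Longrightarrow> mor_eq C' (w' \<odot> g') v \<Longrightarrow>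
        mor_eq P w' w"
    using outer X hom_comp[OF f u] v unfolding pushout_def by meson
  have uC: "mor_eq K (u \<odot> f \<odot> l) ((u \<odot> g) \<odot> c)"
    using fl by (simp add: mor_eq_def)
  \<comment> \<open>\<open>z\<close> mediates for the cocone that \<open>u\<close> induces on the
    left square. Both \<open>w \<odot> p\<close> and \<open>u\<close> solve that problem, so they
    agree on \<open>G\<close>.\<close>
  obtain z where z: "\<And>w'. hom G X w' \<Longrightarrow> mor_eq L (w' \<odot> f) (u \<odot> f) \<Longrightarrow> mor_eq C (w' \<odot> g) (u \<odot> g) \<Longrightarrow>
      mor_eq G w' z"
    using left X hom_comp[OF f u] hom_comp[OF g u] uC unfolding pushout_def by meson
  have wpg: "mor_eq C ((w \<odot> p) \<odot> g) (u \<odot> g)"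
  proof -
    have "fst w (fst p (fst g a)) = fst u (fst g a)" if a: "a \<in> nodes C" for a
      using a uv sq w(3) homD(1)[OF q a] by (auto simp: mor_eq_def)
    moreover have "snd w (snd p (snd g a)) = snd u (snd g a)" if a: "a \<in> edges C" for a
      using a uv sq w(3) homD(2)[OF q a] by (auto simp: mor_eq_def)
    ultimately show ?thesis by (simp add: mor_eq_def)
  qed
  have "mor_eq G (w \<odot> p) z"
    using z[OF hom_comp[OF p w(1)] _ wpg] w(2) by (simp add: mor_eq_def)
  moreover have "mor_eq G u z" using z[OF u] by (simp add: mor_eq_def)
  ultimately have wp: "mor_eq G (w \<odot> p) u" by (simp add: mor_eq_def)
  moreover have "mor_eq P w' w" if "hom P X w'" "mor_eq G (w' \<odot> p) u" "mor_eq C' (w' \<odot> g') v" for w'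
    using that uniq[of w'] homD(1,2)[OF f] by (simp add: mor_eq_def)
  ultimately show "\<exists>w. hom P X w \<and> mor_eq G (w \<odot> p) u \<and> mor_eq C' (w \<odot> g') v \<and>
      (\<forall>w'. hom P X w' \<and> mor_eq G (w' \<odot> p) u \<and> mor_eq C' (w' \<odot> g') v \<longrightarrow> mor_eq P w' w)"
    using w by blast
qed

section \<open>Boundary complements and convex steps\<close>

text \<open>Each leg is injective and so is \<open>h\<close>, so \<open>k\<close> can merge an
  \<open>i\<close> node with a \<open>j\<close> node but never two nodes of the same half. Removing
  either half of the boundary restores injectivity.\<close>

lemma gluing_inj_on:
  assumes gl: "gluing (i + j) B C D (copair i l\<^sub>i l\<^sub>j) (copair i c\<^sub>1 c\<^sub>2) h k"
    and l: "hom (disc i) B l\<^sub>i" "hom (disc j) B l\<^sub>j" "inj_on (fst l\<^sub>i) {..<i}"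
        "inj_on (fst l\<^sub>j) {..<j}"
  shows "inj_on (fst k) (nodes C - fst c\<^sub>1 ` {..<i})" "inj_on (fst k) (nodes C - fst c\<^sub>2 ` {..<j})"
    "\<And>a. a < i \<Longrightarrow> fst k (fst c\<^sub>1 a) = fst h (fst l\<^sub>i a)"
    "\<And>b. b < j \<Longrightarrow> fst k (fst c\<^sub>2 b) = fst h (fst l\<^sub>j b)"
proof -
  let ?N = "nodes C - (fst c\<^sub>1 ` {..<i} \<union> fst c\<^sub>2 ` {..<j})"
  have comm: "\<And>a. a < i + j \<Longrightarrow> fst h (fst (copair i l\<^sub>i l\<^sub>j) a) = fst k (fst (copair i c\<^sub>1 c\<^sub>2) a)"
    and h: "inj_on (fst h) (nodes B)" and kN: "inj_on (fst k) ?N"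
    and disj: "fst h ` nodes B \<inter> fst k ` ?N = {}"
    using gl unfolding gluing_def mono_mor_def copair_image by auto
  show k1: "fst k (fst c\<^sub>1 a) = fst h (fst l\<^sub>i a)" if "a < i" for a
    using comm[of a] that by (simp add: fst_copair)
  show k2: "fst k (fst c\<^sub>2 b) = fst h (fst l\<^sub>j b)" if "b < j" for b
    using comm[of "i + b"] that by (simp add: fst_copair)
  have "inj_on (fst k) (?N \<union> fst c ` {..<q})"
    if lq: "hom (disc q) B l" "inj_on (fst l) {..<q}"
      and kq: "\<And>b. b < q \<Longrightarrow> fst k (fst c b) = fst h (fst l b)"
    for q l and c :: mor
  proof -
    have lB: "fst l b \<in> nodes B" if "b < q" for b using \<open>hom (disc q) B l\<close> that
        by (simp add: hom_disc_iff)
    have "inj_on (fst k) (fst c ` {..<q})"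
    proof (rule inj_onI)
      fix x y assume "x \<in> fst c ` {..<q}" "y \<in> fst c ` {..<q}" "fst k x = fst k y"
      then obtain a b where "a < q" "b < q" "x = fst c a" "y = fst c b"
          "fst h (fst l a) = fst h (fst l b)"
        using kq by auto
      then show "x = y" using lB h lq(2) by (metis inj_onD lessThan_iff)
    qed
    moreover have "fst k ` fst c ` {..<q} \<subseteq> fst h ` nodes B" using kq lB by auto
    ultimately show ?thesis using kN disj unfolding inj_on_Un by blast
  qed
  note ext = this
  show "inj_on (fst k) (nodes C - fst c\<^sub>1 ` {..<i})"
    by (rule inj_on_subset[OF ext[OF l(2,4) k2]]) auto
  show "inj_on (fst k) (nodes C - fst c\<^sub>2 ` {..<j})"
    by (rule inj_on_subset[OF ext[OF l(1,3) k1]]) auto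
qed

text \<open>The boundary is shared out: nodes of the \<open>J\<close> half are free in
  \<open>R\<close>, so only \<open>C\<close> can use them, while nodes of \<open>I\<close> are free
  in \<open>C\<close>, so only \<open>R\<close> can. Hence no node is used from both sides. Plain
  sets are used because the lemma is applied to sources and, with the halves exchanged, to
  targets.\<close>

lemma gluing_free_ends:
  fixes h k c c' d :: "nat \<Rightarrow> nat"
  assumes h: "inj_on h N\<^sub>R" and S: "S\<^sub>R \<subseteq> N\<^sub>R" "S\<^sub>C \<subseteq> N\<^sub>C"
    and kc: "\<And>b. b \<in> J \<Longrightarrow> k (c b) = h (r b)" and r: "r ` J = N\<^sub>R - S\<^sub>R"
    and cN: "c ` J \<subseteq> N\<^sub>C" and kinj: "inj_on k (N\<^sub>C - I)"
    and disj: "h ` N\<^sub>R \<inter> k ` (N\<^sub>C - (I \<union> c ` J)) = {}"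
    and C: "N\<^sub>C - S\<^sub>C = d ` M \<union> I" and dis: "d ` M \<inter> I = {}" "c ` J \<inter> I = {}"
  shows "h ` S\<^sub>R \<inter> k ` S\<^sub>C = {}"
    and "k ` d ` M = (h ` N\<^sub>R \<union> k ` (N\<^sub>C - (I \<union> c ` J))) - (h ` S\<^sub>R \<union> k ` S\<^sub>C)"
proof -
  have SI: "S\<^sub>C \<inter> I = {}" using C by blast
  have key: "k x \<notin> h ` S\<^sub>R" if x: "x \<in> N\<^sub>C - I" for x
  proof
    assume "k x \<in> h ` S\<^sub>R"
    then obtain s where s: "s \<in> S\<^sub>R" "k x = h s" by blast
    then have "x \<in> c ` J" using disj x S by blast
    then obtain b where "b \<in> J" "x = c b" by blast
    then have "h (r b) = h s" "r b \<in> N\<^sub>R - S\<^sub>R" using kc s r by auto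
    then show False using h s S by (metis Diff_iff inj_onD subsetD)
  qed
  show "h ` S\<^sub>R \<inter> k ` S\<^sub>C = {}"
  proof (intro equals0I, elim IntE imageE[of _ k])
    fix y x assume "y \<in> h ` S\<^sub>R" "y = k x" "x \<in> S\<^sub>C"
    moreover then have "x \<in> N\<^sub>C - I" using SI S by blast
    ultimately show False using key[of x] by simp
  qed
  show "k ` d ` M = (h ` N\<^sub>R \<union> k ` (N\<^sub>C - (I \<union> c ` J))) - (h ` S\<^sub>R \<union> k ` S\<^sub>C)" (is "_ = ?D - ?S")
  proof
    show "k ` d ` M \<subseteq> ?D - ?S"
    proof
      fix y assume "y \<in> k ` d ` M"
      then obtain x where x: "x \<in> N\<^sub>C - I" "x \<notin> S\<^sub>C" "y = k x" using C dis by blast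
      have "y \<in> ?D"
      proof (cases "x \<in> c ` J")
        case True
        then obtain b where "b \<in> J" "y = h (r b)" using x kc by auto
        with r show ?thesis by blast
      qed (use x in blast)
      moreover have "y \<notin> k ` S\<^sub>C"
        using x kinj SI S by (auto dest: inj_onD)
      moreover have "y \<notin> h ` S\<^sub>R" using key[OF x(1)] x(3) by simp
      ultimately show "y \<in> ?D - ?S" by blast
    qed
    show "?D - ?S \<subseteq> k ` d ` M"
    proof
      fix y assume y: "y \<in> ?D - ?S"
      have "\<exists>x\<in>N\<^sub>C - I. y = k x"
      proof (cases "y \<in> h ` N\<^sub>R")
        case True
        then obtain s where s: "s \<in> N\<^sub>R - S\<^sub>R" "y = h s" using y by blast
        then obtain b where "b \<in> J" "s = r b" unfolding r[symmetric] by blast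
        with s kc have "b \<in> J" "y = k (c b)" by simp_all
        then show ?thesis using cN dis by blast
      qed (use y in blast)
      then obtain x where "x \<in> N\<^sub>C - I" "y = k x" by blast
      moreover then have "x \<notin> S\<^sub>C" using y by blast
      ultimately show "y \<in> k ` d ` M" using C by blast
    qed
  qed
qed

text \<open>Injectivity is asked only on the ends, since the map out of the context is injective on
  its sources and on its targets but perhaps not on all its nodes.\<close>

lemma disjoint_ends_Un:
  assumes 1: "disjoint_ends E\<^sub>1 s\<^sub>1" and 2: "disjoint_ends E\<^sub>2 s\<^sub>2"
    and h: "\<And>e. e \<in> E\<^sub>1 \<Longrightarrow> s (h\<^sub>e e) = map h (s\<^sub>1 e)"
        and k: "\<And>e. e \<in> E\<^sub>2 \<Longrightarrow> s (k\<^sub>e e) = map k (s\<^sub>2 e)"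
    and inj: "inj_on h (ends E\<^sub>1 s\<^sub>1)" "inj_on k (ends E\<^sub>2 s\<^sub>2)"
    and disj: "h ` ends E\<^sub>1 s\<^sub>1 \<inter> k ` ends E\<^sub>2 s\<^sub>2 = {}"
  shows "disjoint_ends (h\<^sub>e ` E\<^sub>1 \<union> k\<^sub>e ` E\<^sub>2) s"
proof -
  have *: "d = d' \<and> l = l'"
    if "disjoint_ends E s'" "inj_on f (ends E s')" "d \<in> E" "d' \<in> E" "l < length (s' d)"
        "l' < length (s' d')"
      "f (s' d ! l) = f (s' d' ! l')" for E f s' d d' l l'
  proof -
    have "s' d ! l \<in> ends E s'" "s' d' ! l' \<in> ends E s'"
      using that unfolding ends_def by (blast intro: nth_mem)+
    then have "s' d ! l = s' d' ! l'" using that by (auto dest: inj_onD)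
    then show ?thesis using disjoint_endsD[OF that(1)] that by blast
  qed
  have x: False if "d \<in> E\<^sub>1" "d' \<in> E\<^sub>2" "l < length (s\<^sub>1 d)" "l' < length (s\<^sub>2 d')"
      "h (s\<^sub>1 d ! l) = k (s\<^sub>2 d' ! l')"
    for d d' l l'
  proof -
    have "s\<^sub>1 d ! l \<in> ends E\<^sub>1 s\<^sub>1" "s\<^sub>2 d' ! l' \<in> ends E\<^sub>2 s\<^sub>2"
      using that unfolding ends_def by (blast intro: nth_mem)+
    then show False using disj that by (metis disjoint_iff imageI)
  qed
  show ?thesis
  proof (rule disjoint_endsI)
    fix e l e' l'
    assume "e \<in> h\<^sub>e ` E\<^sub>1 \<union> k\<^sub>e ` E\<^sub>2" "e' \<in> h\<^sub>e ` E\<^sub>1 \<union> k\<^sub>e ` E\<^sub>2" "l < length (s e)"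
        "l' < length (s e')" "s e ! l = s e' ! l'"
    then show "e = e' \<and> l = l'"
      using *[OF 1 inj(1)] *[OF 2 inj(2)] x h k
      by (elim UnE imageE) (simp_all, blast, metis, metis, blast)
  qed
qed

lemma ends_hom:
  assumes "hom G H f"
  shows "ends (snd f ` edges G) (src H) = fst f ` sources G"
      "ends (snd f ` edges G) (tgt H) = fst f ` targets G"
  using homD[OF assms] by (auto simp: ends_def)

lemma ends_Un: "ends (E \<union> E') s = ends E s \<union> ends E' s"
  by (auto simp: ends_def)

lemma ma_cospanD:
  assumes "ma_cospan S n f G g m"
  shows "hypergraph S G" "acyclic (arcs G)" "disjoint_ends (edges G) (src G)"
      "disjoint_ends (edges G) (tgt G)"
    "hom (disc n) G f" "inj_on (fst f) {..<n}" "fst f ` {..<n} = nodes G - targets G"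
    "hom (disc m) G g" "inj_on (fst g) {..<m}" "fst g ` {..<m} = nodes G - sources G"
  using assms by (auto simp: ma_cospan_def ma_hypergraph_iff mono_mor_disc_iff inputs_eq outputs_eq)

lemma ma_cospanI:
  assumes "hypergraph S G" "acyclic (arcs G)" "disjoint_ends (edges G) (src G)"
      "disjoint_ends (edges G) (tgt G)"
    "inj_on (fst f) {..<n}" "fst f ` {..<n} = nodes G - targets G"
    "inj_on (fst g) {..<m}" "fst g ` {..<m} = nodes G - sources G"
  shows "ma_cospan S n f G g m"
proof -
  have "hom (disc n) G f" "hom (disc m) G g" unfolding hom_disc_iff using assms(6,8) by blast+
  then show ?thesis
    using assms by (auto simp: ma_cospan_def ma_hypergraph_iff mono_mor_disc_iff inputs_eq
        outputs_eq)
qed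

text \<open>
  Rank the context nodes from which some \<open>c\<^sub>1\<close>-node is reachable below \<open>R\<close>, and all other context
  nodes above \<open>R\<close>.
\<close>

lemma gluing_acyclic:
  assumes R: "hypergraph S R" "acyclic (arcs R)" and C: "hypergraph S C" "acyclic (arcs C)"
    and gl: "gluing (i + j) R C D (copair i r\<^sub>i r\<^sub>j) (copair i c\<^sub>1 c\<^sub>2) h k"
    and r: "hom (disc i) R r\<^sub>i" "hom (disc j) R r\<^sub>j" "inj_on (fst r\<^sub>i) {..<i}"
        "inj_on (fst r\<^sub>j) {..<j}"
    and c: "fst c\<^sub>1 ` {..<i} \<inter> sources C = {}" "fst c\<^sub>2 ` {..<j} \<inter> targets C = {}"
    and nopath: "\<And>a b. a < i \<Longrightarrow> b < j \<Longrightarrow> (fst c\<^sub>2 b, fst c\<^sub>1 a) \<notin> (arcs C)\<^sup>+"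
  shows "acyclic (arcs D)"
proof -
  let ?N = "nodes C - (fst c\<^sub>1 ` {..<i} \<union> fst c\<^sub>2 ` {..<j})"
  note k12 = gluing_inj_on(3,4)[OF gl r]
  have h: "hom R D h" and k: "hom C D k" and hinj: "inj_on (fst h) (nodes R)"
      and kN: "inj_on (fst k) ?N"
    and disj: "fst h ` nodes R \<inter> fst k ` ?N = {}"
    and eD: "edges D = snd h ` edges R \<union> snd k ` edges C"
    using gl unfolding gluing_def mono_mor_def copair_image by auto
  obtain \<rho>\<^sub>R :: "nat \<Rightarrow> nat" and K\<^sub>R where "arcs R \<subseteq> measure \<rho>\<^sub>R" "\<forall>v. \<rho>\<^sub>R v < K\<^sub>R"
    by (rule acyclic_arcs_bounded_rank[OF R])
  then have \<rho>\<^sub>R: "\<And>s t. (s, t) \<in> arcs R \<Longrightarrow> \<rho>\<^sub>R s < \<rho>\<^sub>R t" "\<And>v. \<rho>\<^sub>R v < K\<^sub>R"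
    by auto
  obtain \<rho>\<^sub>C :: "nat \<Rightarrow> nat" and K\<^sub>C where "arcs C \<subseteq> measure \<rho>\<^sub>C" "\<forall>v. \<rho>\<^sub>C v < K\<^sub>C"
    by (rule acyclic_arcs_bounded_rank[OF C])
  then have \<rho>\<^sub>C: "\<And>s t. (s, t) \<in> arcs C \<Longrightarrow> \<rho>\<^sub>C s < \<rho>\<^sub>C t" "\<And>v. \<rho>\<^sub>C v < K\<^sub>C"
    by auto
  define low where "low x \<longleftrightarrow> (\<exists>a<i. (x, fst c\<^sub>1 a) \<in> (arcs C)\<^sup>+)" for x
  \<comment> \<open>Three layers: low context nodes stay below \<open>K\<^sub>C\<close>, the nodes
    of \<open>R\<close> fill the range from \<open>K\<^sub>C\<close> to
    \<open>K\<^sub>C + K\<^sub>R\<close>, and the remaining context nodes start at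
    \<open>K\<^sub>C + K\<^sub>R\<close>.\<close>
  define \<rho> where "\<rho> y = (if y \<in> fst h ` nodes R then K\<^sub>C + \<rho>\<^sub>R (inv_into (nodes R) (fst h) y)
    else (let x = inv_into ?N (fst k) y in if low x then \<rho>\<^sub>C x else K\<^sub>C + K\<^sub>R + \<rho>\<^sub>C x))" for y
  have \<rho>h: "\<rho> (fst h x) = K\<^sub>C + \<rho>\<^sub>R x" if "x \<in> nodes R" for x
    using that hinj by (simp add: \<rho>_def)
  have \<rho>k: "\<rho> (fst k x) = (if low x then \<rho>\<^sub>C x else K\<^sub>C + K\<^sub>R + \<rho>\<^sub>C x)" if x: "x \<in> ?N" for x
  proof -
    have "fst k x \<notin> fst h ` nodes R" using disj x by blast
    then show ?thesis unfolding \<rho>_def Let_def using inv_into_f_f[OF kN x] by (simp only: if_False)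
  qed
  have \<rho>c: "K\<^sub>C \<le> \<rho> (fst k x) \<and> \<rho> (fst k x) < K\<^sub>C + K\<^sub>R"
      if x: "x \<in> fst c\<^sub>1 ` {..<i} \<union> fst c\<^sub>2 ` {..<j}" for x
  proof -
    from x k12 r obtain y where "y \<in> nodes R" "fst k x = fst h y" by (auto simp: hom_disc_iff)
    then show ?thesis using \<rho>h \<rho>\<^sub>R(2)[of y] by simp
  qed
  show ?thesis
  proof (rule acyclic_arcsI)
    fix s t assume "(s, t) \<in> arcs D"
    then obtain e where e: "e \<in> edges D" "s \<in> set (src D e)" "t \<in> set (tgt D e)"
      unfolding arcs_def by blast
    show "\<rho> s < \<rho> t"
    proof (cases "e \<in> snd h ` edges R")
      case True
      then obtain d where d: "d \<in> edges R" "e = snd h d" by blast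
      with e homD[OF h] obtain s' t' where st: "s = fst h s'" "t = fst h t'" "s' \<in> set (src R d)"
          "t' \<in> set (tgt R d)"
        by auto
      then have "(s', t') \<in> arcs R" "s' \<in> nodes R" "t' \<in> nodes R" using d R
          by (auto simp: hypergraph_def intro: arcsI)
      then show ?thesis using \<rho>h st \<rho>\<^sub>R(1) by simp
    next
      case False
      with e eD obtain d where d: "d \<in> edges C" "e = snd k d" by blast
      with e homD[OF k] obtain s' t' where st: "s = fst k s'" "t = fst k t'" "s' \<in> set (src C d)"
          "t' \<in> set (tgt C d)"
        by auto
      then have arc: "(s', t') \<in> arcs C" and n: "s' \<in> nodes C" "t' \<in> nodes C"
        using d C by (auto simp: hypergraph_def intro: arcsI)
      have s1: "s' \<notin> fst c\<^sub>1 ` {..<i}" and t2: "t' \<notin> fst c\<^sub>2 ` {..<j}"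
        using c st d unfolding ends_def by blast+
      \<comment> \<open>A low \<open>c\<^sub>2\<close> node would contradict \<open>nopath\<close>,
        and a \<open>c\<^sub>1\<close> node is no source in \<open>C\<close>. So a low source is off
        the boundary and really ranked in the bottom layer.\<close>
      have low_s: "s' \<in> ?N" if "low s'"
        using that nopath n s1 unfolding low_def by auto
      \<comment> \<open>Anything with an arc into a low node or a \<open>c\<^sub>1\<close> node is
        itself low, so no arc leads down from the top layer or from \<open>R\<close>.\<close>
      consider "t' \<in> ?N" "low t'" | "t' \<in> fst c\<^sub>1 ` {..<i}" | "t' \<in> ?N" "\<not> low t'" using t2 n
          by blast
      then show ?thesis
      proof cases
        case 1
        then have "low s'" using arc unfolding low_def by (meson trancl_into_trancl2)
        with 1 low_s show ?thesis using st \<rho>k \<rho>\<^sub>C(1)[OF arc] by simp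
      next
        case 2
        then have "low s'" using arc unfolding low_def by auto
        then have "\<rho> s < K\<^sub>C" using st \<rho>k[OF low_s] \<rho>\<^sub>C(2) by simp
        then show ?thesis using st \<rho>c[of t'] 2 by simp
      next
        case 3
        then have t: "\<rho> t = K\<^sub>C + K\<^sub>R + \<rho>\<^sub>C t'" using st \<rho>k by simp
        show ?thesis
        proof (cases "s' \<in> ?N")
          case True
          then show ?thesis using t st \<rho>k[OF True] \<rho>\<^sub>C(1)[OF arc] by (simp split: if_splits)
        next
          case False
          then show ?thesis using t st \<rho>c[of s'] n by simp
        qed
      qed
    qed
  qed
qed

text \<open>The context sees the boundary of the match reversed: \<open>j\<close> nodes are inputs
  of \<open>C\<close> and \<open>i\<close> nodes are outputs. Gluing \<open>R\<close> in closes off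
  exactly these ends and leaves \<open>n\<close> and \<open>m\<close>; \<open>nopath\<close> rules
  out feedback from the outputs of \<open>R\<close> to its inputs.\<close>

lemma gluing_ma_cospan:
  assumes R: "ma_cospan S i r\<^sub>i R r\<^sub>j j"
    and C: "ma_cospan S (j + n) (copair j c\<^sub>2 d\<^sub>1) C (copair m d\<^sub>2 c\<^sub>1) (m + i)"
    and mono: "inj_on (fst (copair i c\<^sub>1 c\<^sub>2)) {..<i + j}"
    and D: "hypergraph S D" and gl: "gluing (i + j) R C D (copair i r\<^sub>i r\<^sub>j) (copair i c\<^sub>1 c\<^sub>2) h k"
    and nopath: "\<And>a b. a < i \<Longrightarrow> b < j \<Longrightarrow> (fst c\<^sub>2 b, fst c\<^sub>1 a) \<notin> (arcs C)\<^sup>+"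
  shows "ma_cospan S n (k \<odot> d\<^sub>1) D (k \<odot> d\<^sub>2) m"
proof -
  let ?N = "nodes C - (fst c\<^sub>1 ` {..<i} \<union> fst c\<^sub>2 ` {..<j})"
  note R' = ma_cospanD[OF R]
  note C' = ma_cospanD[OF C, unfolded copair_image copair_inj_iff]
  note k' = gluing_inj_on[OF gl R'(5,8,6,9)]
  have h: "hom R D h" and k: "hom C D k" and hinj: "inj_on (fst h) (nodes R)"
    and disj: "fst h ` nodes R \<inter> fst k ` ?N = {}"
    and nD: "nodes D = fst h ` nodes R \<union> fst k ` ?N"
    and eD: "edges D = snd h ` edges R \<union> snd k ` edges C"
    using gl unfolding gluing_def mono_mor_def copair_image by auto
  have cN: "fst c\<^sub>2 ` {..<j} \<subseteq> nodes C" "fst c\<^sub>1 ` {..<i} \<subseteq> nodes C" using C'(7,10) by blast+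
  have c12: "fst c\<^sub>1 ` {..<i} \<inter> fst c\<^sub>2 ` {..<j} = {}" using mono by (simp add: copair_inj_iff)
  have srcD: "sources D = fst h ` sources R \<union> fst k ` sources C"
    unfolding eD ends_Un ends_hom[OF h] ends_hom[OF k] by (rule refl)
  have tgtD: "targets D = fst h ` targets R \<union> fst k ` targets C"
    unfolding eD ends_Un ends_hom[OF h] ends_hom[OF k] by (rule refl)
  have RS: "sources R \<subseteq> nodes R" "targets R \<subseteq> nodes R" and CS: "sources C \<subseteq> nodes C"
      "targets C \<subseteq> nodes C"
    using hypergraph_ends[OF R'(1)] hypergraph_ends[OF C'(1)] by simp_all
  have rj: "fst r\<^sub>j ` {..<j} = nodes R - sources R" and ri: "fst r\<^sub>i ` {..<i} = nodes R - targets R"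
    and ki: "inj_on (fst k) (nodes C - fst c\<^sub>1 ` {..<i})"
        "inj_on (fst k) (nodes C - fst c\<^sub>2 ` {..<j})"
    using R' k' by simp_all
  have kc: "\<And>a. a \<in> {..<i} \<Longrightarrow> fst k (fst c\<^sub>1 a) = fst h (fst r\<^sub>i a)"
    "\<And>b. b \<in> {..<j} \<Longrightarrow> fst k (fst c\<^sub>2 b) = fst h (fst r\<^sub>j b)"
    using k'(3,4) by simp_all
  have dC: "nodes C - sources C = fst d\<^sub>2 ` {..<m} \<union> fst c\<^sub>1 ` {..<i}"
    "nodes C - targets C = fst d\<^sub>1 ` {..<n} \<union> fst c\<^sub>2 ` {..<j}"
    "fst d\<^sub>2 ` {..<m} \<inter> fst c\<^sub>1 ` {..<i} = {}" "fst d\<^sub>1 ` {..<n} \<inter> fst c\<^sub>2 ` {..<j} = {}"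
    using C'(6,7,9,10) by (simp_all only: Un_commute Int_commute)
  have c21: "fst c\<^sub>2 ` {..<j} \<inter> fst c\<^sub>1 ` {..<i} = {}" using c12 by blast
  have disj': "fst h ` nodes R \<inter> fst k ` (nodes C - (fst c\<^sub>2 ` {..<j} \<union> fst c\<^sub>1 ` {..<i})) = {}"
    using disj by (simp only: Un_commute)
  have out: "fst h ` sources R \<inter> fst k ` sources C = {}"
    "fst k ` fst d\<^sub>2 ` {..<m} = nodes D - sources D"
    unfolding nD srcD
    by (rule gluing_free_ends[of "fst h" "nodes R" "sources R" "sources C" "nodes C" "{..<j}"
        "fst k"
        "fst c\<^sub>2" "fst r\<^sub>j" "fst c\<^sub>1 ` {..<i}" "fst d\<^sub>2" "{..<m}"]; fact)+
  have inp: "fst h ` targets R \<inter> fst k ` targets C = {}"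
    "fst k ` fst d\<^sub>1 ` {..<n} = nodes D - targets D"
    unfolding nD tgtD Un_commute[of "fst c\<^sub>1 ` {..<i}" "fst c\<^sub>2 ` {..<j}"]
    by (rule gluing_free_ends[of "fst h" "nodes R" "targets R" "targets C" "nodes C" "{..<i}"
        "fst k"
        "fst c\<^sub>1" "fst r\<^sub>i" "fst c\<^sub>2 ` {..<j}" "fst d\<^sub>1" "{..<n}"]; fact)+
  have split: "A \<subseteq> N - X" "Z \<subseteq> N - X" if "N - A = Z \<union> X" "Z \<inter> X = {}" "A \<subseteq> N" for N A X Z ::
      "nat set"
    using that by blast+
  have sC: "sources C \<subseteq> nodes C - fst c\<^sub>1 ` {..<i}" "targets C \<subseteq> nodes C - fst c\<^sub>2 ` {..<j}"
    by (rule split(1)[OF dC(1,3) CS(1)], rule split(1)[OF dC(2,4) CS(2)])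
  show ?thesis
  proof (rule ma_cospanI)
    show "hypergraph S D" by fact
    show "acyclic (arcs D)"
    proof (rule gluing_acyclic[OF R'(1,2) C'(1,2) gl R'(5,8,6,9) _ _ nopath])
      show "fst c\<^sub>1 ` {..<i} \<inter> sources C = {}" "fst c\<^sub>2 ` {..<j} \<inter> targets C = {}"
        using sC by (auto dest: subsetD)
    qed
    show "disjoint_ends (edges D) (src D)" unfolding eD
      by (rule disjoint_ends_Un[where h = "fst h" and k = "fst k", OF R'(3) C'(3)])
        (use hinj RS sC k' out homD[OF h] homD[OF k] in \<open>auto intro: inj_on_subset\<close>)
    show "disjoint_ends (edges D) (tgt D)" unfolding eD
      by (rule disjoint_ends_Un[where h = "fst h" and k = "fst k", OF R'(4) C'(4)])
        (use hinj RS sC k' inp homD[OF h] homD[OF k] in \<open>auto intro: inj_on_subset\<close>)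
    have img: "fst (k \<odot> d) ` X = fst k ` fst d ` X" for d X by (simp add: image_image)
    show "fst (k \<odot> d\<^sub>1) ` {..<n} = nodes D - targets D"
        "fst (k \<odot> d\<^sub>2) ` {..<m} = nodes D - sources D"
      unfolding img using inp out by simp_all
    have "fst d\<^sub>1 ` {..<n} \<subseteq> nodes C - fst c\<^sub>2 ` {..<j}"
        "fst d\<^sub>2 ` {..<m} \<subseteq> nodes C - fst c\<^sub>1 ` {..<i}"
      by (rule split(2)[OF dC(2,4) CS(2)], rule split(2)[OF dC(1,3) CS(1)])
    then have "inj_on (fst k) (fst d\<^sub>1 ` {..<n})" "inj_on (fst k) (fst d\<^sub>2 ` {..<m})"
      using inj_on_subset[OF ki(2)] inj_on_subset[OF ki(1)] by simp_all
    then show "inj_on (fst (k \<odot> d\<^sub>1)) {..<n}" "inj_on (fst (k \<odot> d\<^sub>2)) {..<m}"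
      using C'(6,9) unfolding mor_comp_def fst_conv by (simp_all add: comp_inj_on)
  qed
qed

text \<open>\<open>sec\<close> chooses, for a node that can carry an end outside the match, its copy
  on the proper side of the cut, and \<open>k\<close> undoes the choice. \<open>Q\<close> is the
  half of the boundary on the other side, which receives no ends; so the context has as free ends
  \<open>Q\<close> and the copies of the free ends of \<open>P\<close>.\<close>

lemma complement_free_ends:
  fixes k sec :: "nat \<Rightarrow> nat"
  assumes sec: "\<And>v. v \<in> N\<^sub>P - G \<Longrightarrow> sec v \<in> N\<^sub>C - Q \<and> k (sec v) = v"
    and ret: "\<And>x. x \<in> N\<^sub>C - Q \<Longrightarrow> k x \<in> N\<^sub>P - G \<and> sec (k x) = x"
    and Q: "Q \<subseteq> N\<^sub>C" and S: "S\<^sub>P = G \<union> E" "S\<^sub>P \<subseteq> N\<^sub>P" "G \<inter> E = {}"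
  shows "N\<^sub>C - sec ` E = Q \<union> sec ` (N\<^sub>P - S\<^sub>P)" "Q \<inter> sec ` (N\<^sub>P - S\<^sub>P) = {}"
    "inj_on sec (N\<^sub>P - S\<^sub>P)"
proof -
  have secQ: "sec v \<notin> Q" "sec v \<in> N\<^sub>C" "k (sec v) = v" if "v \<in> N\<^sub>P - G" for v
    using sec[OF that] by simp_all
  have E: "v \<in> N\<^sub>P - G" if "v \<in> E" for v using S that by blast
  have F: "v \<in> N\<^sub>P - G" "v \<notin> E" if "v \<in> N\<^sub>P - S\<^sub>P" for v using S that by blast+
  show "inj_on sec (N\<^sub>P - S\<^sub>P)" by (rule inj_onI) (metis F(1) secQ(3))
  show "Q \<inter> sec ` (N\<^sub>P - S\<^sub>P) = {}" using secQ(1) F(1) by (auto simp del: Diff_iff)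
  show "N\<^sub>C - sec ` E = Q \<union> sec ` (N\<^sub>P - S\<^sub>P)"
  proof (intro equalityI subsetI)
    fix x assume x: "x \<in> N\<^sub>C - sec ` E"
    show "x \<in> Q \<union> sec ` (N\<^sub>P - S\<^sub>P)"
    proof (cases "x \<in> Q")
      case False
      then have r: "k x \<in> N\<^sub>P - G" "sec (k x) = x" using ret[of x] x by simp_all
      then have "k x \<notin> E" using x by (metis DiffD2 imageI)
      then have "k x \<in> N\<^sub>P - S\<^sub>P" using r S by blast
      then have "sec (k x) \<in> sec ` (N\<^sub>P - S\<^sub>P)" by (rule imageI)
      then show ?thesis unfolding r(2) by blast
    qed simp
  next
    fix x assume "x \<in> Q \<union> sec ` (N\<^sub>P - S\<^sub>P)"
    then show "x \<in> N\<^sub>C - sec ` E"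
    proof (elim UnE imageE)
      assume x: "x \<in> Q"
      have "x \<notin> sec ` E" using secQ(1) E x by (metis imageE)
      then show ?thesis using x Q by blast
    next
      fix v assume v: "x = sec v" "v \<in> N\<^sub>P - S\<^sub>P"
      have "x \<notin> sec ` E"
      proof
        assume "x \<in> sec ` E"
        then obtain w where "w \<in> E" "sec w = sec v" using v by auto
        then have "w = v" using secQ(3) E F(1) v by metis
        then show False using F(2) v \<open>w \<in> E\<close> by blast
      qed
      then show ?thesis using secQ(2)[OF F(1)[OF v(2)]] v(1) by simp
    qed
  qed
qed

text \<open>By the degree bounds in \<open>P\<close>, an edge outside the match can meet it with a
  source only at an output of \<open>L\<close> and with a target only at an input of
  \<open>L\<close>. So every such end has a definite copy: sources go to the \<open>j\<close> copy
  and targets to the \<open>i\<close> copy, and a node that is both is separated in two.\<close>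

lemma boundary_complement_exists:
  assumes L: "ma_cospan S i l\<^sub>i L l\<^sub>j j" and P: "ma_cospan S n x\<^sub>1 P x\<^sub>2 m"
    and g: "hom L P g" "mono_mor L g"
  obtains C c\<^sub>1 c\<^sub>2 d\<^sub>1 d\<^sub>2 k where
    "gluing (i + j) L C P (copair i l\<^sub>i l\<^sub>j) (copair i c\<^sub>1 c\<^sub>2) g k"
    "inj_on (fst (copair i c\<^sub>1 c\<^sub>2)) {..<i + j}"
    "ma_cospan S (j + n) (copair j c\<^sub>2 d\<^sub>1) C (copair m d\<^sub>2 c\<^sub>1) (m + i)"
    "\<forall>v<n. fst k (fst d\<^sub>1 v) = fst x\<^sub>1 v" "\<forall>v<m. fst k (fst d\<^sub>2 v) = fst x\<^sub>2 v"
proof -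
  note L' = ma_cospanD[OF L] and P' = ma_cospanD[OF P]
  note LS = hypergraph_ends[OF L'(1)] and PS = hypergraph_ends[OF P'(1)]
  have gn: "inj_on (fst g) (nodes L)" using g(2) by (simp add: mono_mor_def)
  have gP: "fst g v \<in> nodes P" if "v \<in> nodes L" for v using homD(1)[OF g(1) that] .
  define G where "G = fst g ` nodes L"
  define E where "E = edges P - snd g ` edges L"
  \<comment> \<open>Boundary node \<open>a\<close> of \<open>i + j\<close> is coded as
    \<open>2 * a\<close>, with \<open>o\<^sub>l\<close> the offset of the leg \<open>l\<close> in
    the boundary, and a node \<open>v\<close> outside the match as \<open>2 * v + 1\<close>. At
    match nodes off the image of \<open>l\<close> the inverse is arbitrary; no edge of
    \<open>E\<close> has an end of the corresponding kind there.\<close>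
  define sec where "sec o\<^sub>l q l v =
    (if v \<in> G then 2 * (o\<^sub>l + inv_into {..<q} (\<lambda>b. fst g (fst l b)) v) else 2 * v + 1)"
    for o\<^sub>l q and l :: mor and v :: nat
  define kn where "kn x = (if even x then fst g (fst (copair i l\<^sub>i l\<^sub>j) (x div 2)) else x div 2)"
      for x
  define N where "N = (\<lambda>a. 2 * a) ` {..<i + j} \<union> (\<lambda>v. 2 * v + 1) ` (nodes P - G)"
  define \<sigma> where "\<sigma> = sec i j l\<^sub>j"
  define \<tau> where "\<tau> = sec 0 i l\<^sub>i"
  define C where "C = \<lparr> nodes = N, edges = E, src = (\<lambda>e. map \<sigma> (src P e)),
    tgt = (\<lambda>e. map \<tau> (tgt P e)), lab = lab P \<rparr>"
  define c\<^sub>1 :: mor where "c\<^sub>1 = (\<lambda>a. 2 * a, id)"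
  define c\<^sub>2 :: mor where "c\<^sub>2 = (\<lambda>b. 2 * (i + b), id)"
  define d\<^sub>1 :: mor where "d\<^sub>1 = (\<lambda>v. \<tau> (fst x\<^sub>1 v), id)"
  define d\<^sub>2 :: mor where "d\<^sub>2 = (\<lambda>v. \<sigma> (fst x\<^sub>2 v), id)"
  define k :: mor where "k = (kn, id)"
  have c: "fst (copair i c\<^sub>1 c\<^sub>2) a = 2 * a" for a
    unfolding fst_copair c\<^sub>1_def c\<^sub>2_def by auto
  have GP: "G \<subseteq> nodes P" using gP unfolding G_def by blast
  have kn_odd: "kn (2 * v + 1) = v" for v by (simp add: kn_def)

  \<comment> \<open>One statement for both sides of the cut: \<open>T\<close> the sources of
    \<open>L\<close>, leg \<open>l\<^sub>j\<close> and offset \<open>i\<close> give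
    \<open>\<sigma>\<close>; the targets, leg \<open>l\<^sub>i\<close> and offset 0 give
    \<open>\<tau>\<close>. \<open>Q\<close> is the half of the boundary belonging to the other
    leg.\<close>
  have splitting: "(\<forall>v\<in>nodes P - fst g ` T. sec o\<^sub>l q l v \<in> N - Q \<and> kn (sec o\<^sub>l q l v) = v) \<and>
      (\<forall>x\<in>N - Q. kn x \<in> nodes P - fst g ` T \<and> sec o\<^sub>l q l (kn x) = x)"
    if kl: "\<And>b. b < q \<Longrightarrow> kn (2 * (o\<^sub>l + b)) = fst g (fst l b)"
      and l: "inj_on (fst l) {..<q}" "fst l ` {..<q} = nodes L - T" and T: "T \<subseteq> nodes L"
      and Q: "(\<lambda>a. 2 * a) ` {..<i + j} = Q \<union> (\<lambda>b. 2 * (o\<^sub>l + b)) ` {..<q}"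
        "Q \<inter> (\<lambda>b. 2 * (o\<^sub>l + b)) ` {..<q} = {}"
    for T o\<^sub>l q Q and l :: mor
  proof -
    have lL: "fst l b \<in> nodes L" "fst l b \<notin> T" if "b < q" for b
      using l(2) that by blast+
    have secl: "sec o\<^sub>l q l (fst g (fst l b)) = 2 * (o\<^sub>l + b)" if b: "b < q" for b
    proof -
      have "inj_on (\<lambda>b. fst g (fst l b)) {..<q}"
      proof (rule inj_onI)
        fix a b assume "a \<in> {..<q}" "b \<in> {..<q}" "fst g (fst l a) = fst g (fst l b)"
        then show "a = b" by (simp add: inj_on_eq_iff[OF gn] inj_on_eq_iff[OF l(1)] lL(1))
      qed
      then have "inv_into {..<q} (\<lambda>b. fst g (fst l b)) (fst g (fst l b)) = b"
        using inv_into_f_f[of "\<lambda>b. fst g (fst l b)" "{..<q}" b] b by blast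
      then show ?thesis using lL(1)[OF b] by (simp add: sec_def G_def)
    qed
    have seco: "sec o\<^sub>l q l v = 2 * v + 1" if "v \<notin> G" for v
      using that by (simp add: sec_def)
    have odd: "2 * v + 1 \<notin> Q" for v
    proof
      assume "2 * v + 1 \<in> Q"
      then have "2 * v + 1 \<in> (\<lambda>a. 2 * a) ` {..<i + j}" using Q(1) by blast
      then show False by (auto, presburger)
    qed
    have "sec o\<^sub>l q l v \<in> N - Q \<and> kn (sec o\<^sub>l q l v) = v" if v: "v \<in> nodes P - fst g ` T" for v
    proof (cases "v \<in> G")
      case True
      then obtain u where u: "u \<in> nodes L" "v = fst g u" unfolding G_def by blast
      then have "u \<in> nodes L - T" using v by blast
      then obtain b where b: "b < q" "u = fst l b" unfolding l(2)[symmetric] by blast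
      have "2 * (o\<^sub>l + b) \<in> (\<lambda>b. 2 * (o\<^sub>l + b)) ` {..<q}" using b by blast
      then have "2 * (o\<^sub>l + b) \<in> N - Q" using Q unfolding N_def by blast
      then show ?thesis using secl b u kl by simp
    next
      case False
      then show ?thesis using v odd kn_odd seco[OF False] by (simp add: N_def)
    qed
    moreover have "kn x \<in> nodes P - fst g ` T \<and> sec o\<^sub>l q l (kn x) = x" if x: "x \<in> N - Q" for x
    proof -
      consider b where "b < q" "x = 2 * (o\<^sub>l + b)" | v where "v \<in> nodes P - G" "x = 2 * v + 1"
        using x Q(1) unfolding N_def by auto
      then show ?thesis
      proof cases
        case 1
        have "fst g (fst l b) \<notin> fst g ` T"
        proof
          assume "fst g (fst l b) \<in> fst g ` T"
          then obtain t where "t \<in> T" "fst g (fst l b) = fst g t" by blast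
          then show False using inj_onD[OF gn, of "fst l b" t] lL[OF 1(1)] T by blast
        qed
        then show ?thesis using 1 kl secl lL gP by simp
      next
        case 2
        then have "v \<notin> fst g ` T" using T unfolding G_def by blast
        then show ?thesis using 2 kn_odd seco by simp
      qed
    qed
    ultimately show ?thesis by blast
  qed
  have even_split: "(\<lambda>a. 2 * a) ` {..<i + j} = fst c\<^sub>1 ` {..<i} \<union> fst c\<^sub>2 ` {..<j}"
    unfolding lessThan_add image_Un image_image c\<^sub>1_def c\<^sub>2_def by simp
  have c12: "fst c\<^sub>1 ` {..<i} \<inter> fst c\<^sub>2 ` {..<j} = {}"
    by (auto simp: c\<^sub>1_def c\<^sub>2_def)
  have "(\<forall>v\<in>nodes P - fst g ` sources L. \<sigma> v \<in> N - fst c\<^sub>1 ` {..<i} \<and> kn (\<sigma> v) = v) \<and>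
      (\<forall>x\<in>N - fst c\<^sub>1 ` {..<i}. kn x \<in> nodes P - fst g ` sources L \<and> \<sigma> (kn x) = x)"
    unfolding \<sigma>_def
  proof (rule splitting[OF _ L'(9,10) LS(1)])
    show "kn (2 * (i + b)) = fst g (fst l\<^sub>j b)" for b by (simp add: kn_def fst_copair)
    show "(\<lambda>a. 2 * a) ` {..<i + j} = fst c\<^sub>1 ` {..<i} \<union> (\<lambda>b. 2 * (i + b)) ` {..<j}"
      "fst c\<^sub>1 ` {..<i} \<inter> (\<lambda>b. 2 * (i + b)) ` {..<j} = {}"
      using even_split c12 by (simp_all add: c\<^sub>2_def)
  qed
  then have \<sigma>: "\<And>v. v \<in> nodes P - fst g ` sources L \<Longrightarrow> \<sigma> v \<in> N - fst c\<^sub>1 ` {..<i} \<and> kn (\<sigma> v) = v"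
    "\<And>x. x \<in> N - fst c\<^sub>1 ` {..<i} \<Longrightarrow> kn x \<in> nodes P - fst g ` sources L \<and> \<sigma> (kn x) = x" by blast+
  have "(\<forall>v\<in>nodes P - fst g ` targets L. \<tau> v \<in> N - fst c\<^sub>2 ` {..<j} \<and> kn (\<tau> v) = v) \<and>
      (\<forall>x\<in>N - fst c\<^sub>2 ` {..<j}. kn x \<in> nodes P - fst g ` targets L \<and> \<tau> (kn x) = x)"
    unfolding \<tau>_def
  proof (rule splitting[OF _ L'(6,7) LS(2)])
    show "kn (2 * (0 + a)) = fst g (fst l\<^sub>i a)" if "a < i" for a using that
        by (simp add: kn_def fst_copair)
    show "(\<lambda>a. 2 * a) ` {..<i + j} = fst c\<^sub>2 ` {..<j} \<union> (\<lambda>a. 2 * (0 + a)) ` {..<i}"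
      "fst c\<^sub>2 ` {..<j} \<inter> (\<lambda>a. 2 * (0 + a)) ` {..<i} = {}"
      using even_split c12 by (simp_all add: c\<^sub>1_def Un_commute Int_commute)
  qed
  then have \<tau>: "\<And>v. v \<in> nodes P - fst g ` targets L \<Longrightarrow> \<tau> v \<in> N - fst c\<^sub>2 ` {..<j} \<and> kn (\<tau> v) = v"
    "\<And>x. x \<in> N - fst c\<^sub>2 ` {..<j} \<Longrightarrow> kn x \<in> nodes P - fst g ` targets L \<and> \<tau> (kn x) = x" by blast+

  have eP: "edges P = snd g ` edges L \<union> E" and eE: "snd g ` edges L \<inter> E = {}"
    using homD(2)[OF g(1)] unfolding E_def by blast+
  have srcP: "sources P = fst g ` sources L \<union> ends E (src P)"
    unfolding eP ends_Un ends_hom[OF g(1)] by (rule refl)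
  have tgtP: "targets P = fst g ` targets L \<union> ends E (tgt P)"
    unfolding eP ends_Un ends_hom[OF g(1)] by (rule refl)
  \<comment> \<open>A node at which an edge of the match and an edge outside both have an end of the
    same kind would have degree at least two in \<open>P\<close>.\<close>
  have disjoint: "ends (snd g ` edges L) s \<inter> ends E s = {}" if "disjoint_ends (edges P) s" for s
  proof (rule equals0I, elim IntE)
    fix v assume "v \<in> ends (snd g ` edges L) s" "v \<in> ends E s"
    then obtain e e' where "e \<in> snd g ` edges L" "e' \<in> E" "v \<in> set (s e)" "v \<in> set (s e')"
      unfolding ends_def by blast
    moreover then have "e = e'" using disjoint_endsD_set[OF that] eP by blast
    ultimately show False using eE by blast
  qed
  have srcE: "fst g ` sources L \<inter> ends E (src P) = {}"
      and tgtE: "fst g ` targets L \<inter> ends E (tgt P) = {}"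
    using disjoint[OF P'(3)] disjoint[OF P'(4)] unfolding ends_hom[OF g(1)] .
  have srcE': "v \<in> nodes P - fst g ` sources L" if "e \<in> E" "v \<in> set (src P e)" for v e
  proof -
    have "v \<in> ends E (src P)" using that unfolding ends_def by blast
    then show ?thesis using srcE srcP PS(1) by blast
  qed
  have tgtE': "v \<in> nodes P - fst g ` targets L" if "e \<in> E" "v \<in> set (tgt P e)" for v e
  proof -
    have "v \<in> ends E (tgt P)" using that unfolding ends_def by blast
    then show ?thesis using tgtE tgtP PS(2) by blast
  qed
  have cN: "fst c\<^sub>1 ` {..<i} \<subseteq> N" "fst c\<^sub>2 ` {..<j} \<subseteq> N" using even_split unfolding N_def by blast+
  have finE: "finite E" using PS by (simp add: E_def)
  have C: "hypergraph S C"
    unfolding hypergraph_def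
  proof (intro conjI ballI)
    show "finite (nodes C)" "finite (edges C)" using PS finE by (simp_all add: C_def N_def)
    fix e assume "e \<in> edges C"
    then have e: "e \<in> E" "e \<in> edges P" by (simp_all add: C_def E_def)
    then show "lab C e \<in> gens S" "length (src C e) = arity S (lab C e)"
        "length (tgt C e) = coarity S (lab C e)"
      using P'(1) by (simp_all add: C_def hypergraph_def)
    show "set (src C e) \<subseteq> nodes C"
    proof
      fix v assume "v \<in> set (src C e)"
      then obtain w where "w \<in> set (src P e)" "v = \<sigma> w" by (auto simp: C_def)
      then show "v \<in> nodes C" using \<sigma>(1)[OF srcE'[OF e(1)]] by (simp add: C_def)
    qed
    show "set (tgt C e) \<subseteq> nodes C"
    proof
      fix v assume "v \<in> set (tgt C e)"
      then obtain w where "w \<in> set (tgt P e)" "v = \<tau> w" by (auto simp: C_def)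
      then show "v \<in> nodes C" using \<tau>(1)[OF tgtE'[OF e(1)]] by (simp add: C_def)
    qed
  qed
  have mapk: "src P e = map kn (src C e)" "tgt P e = map kn (tgt C e)" if e: "e \<in> E" for e
  proof -
    show "src P e = map kn (src C e)" using \<sigma>(1)[OF srcE'[OF e]] by (simp add: C_def map_idI)
    show "tgt P e = map kn (tgt C e)" using \<tau>(1)[OF tgtE'[OF e]] by (simp add: C_def map_idI)
  qed
  have knP: "kn x \<in> nodes P" if "x \<in> N" for x
    using \<sigma>(2)[of x] \<tau>(2)[of x] c12 that by blast
  have k: "hom C P k"
    unfolding hom_def using knP mapk eP by (auto simp: k_def C_def)
  have odds: "N - (\<lambda>a. 2 * a) ` {..<i + j} = (\<lambda>v. 2 * v + 1) ` (nodes P - G)"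
    unfolding N_def by (auto, presburger)
  have kodds: "kn ` (\<lambda>v. 2 * v + 1) ` (nodes P - G) = nodes P - G"
    unfolding image_image kn_odd by simp
  have "gluing (i + j) L C P (copair i l\<^sub>i l\<^sub>j) (copair i c\<^sub>1 c\<^sub>2) g k"
    unfolding gluing_def c
  proof (intro conjI)
    have nC: "nodes C = N" "edges C = E" and fk: "fst k = kn" "snd k = id"
        by (simp_all add: C_def k_def)
    show "hom L P g" "hom C P k" "mono_mor L g" by fact+
    show "\<forall>a<i + j. fst g (fst (copair i l\<^sub>i l\<^sub>j) a) = fst k (2 * a)" by (simp add: k_def kn_def)
    show "inj_on (fst k) (nodes C - (\<lambda>a. 2 * a) ` {..<i + j})"
      unfolding nC odds fk by (auto simp: inj_on_def kn_odd[simplified])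
    show "inj_on (snd k) (edges C)" by (simp add: k_def)
    show "nodes P = fst g ` nodes L \<union> fst k ` (nodes C - (\<lambda>a. 2 * a) ` {..<i + j})"
      "fst g ` nodes L \<inter> fst k ` (nodes C - (\<lambda>a. 2 * a) ` {..<i + j}) = {}"
      unfolding nC odds fk kodds G_def[symmetric] using GP by blast+
    show "edges P = snd g ` edges L \<union> snd k ` edges C" "snd g ` edges L \<inter> snd k ` edges C = {}"
      unfolding nC fk using eP eE by simp_all
  qed
  moreover have "inj_on (fst (copair i c\<^sub>1 c\<^sub>2)) {..<i + j}"
    by (simp add: c inj_on_def)
  moreover have "ma_cospan S (j + n) (copair j c\<^sub>2 d\<^sub>1) C (copair m d\<^sub>2 c\<^sub>1) (m + i)"
  proof (rule ma_cospanI)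
    show "hypergraph S C" by fact
    show "acyclic (arcs C)" by (rule hom_acyclic[OF k P'(2)])
    show "disjoint_ends (edges C) (src C)"
      by (rule disjoint_ends_reflect[OF P'(3), of id _ kn]) (use mapk in \<open>simp_all add: C_def
          E_def\<close>)
    show "disjoint_ends (edges C) (tgt C)"
      by (rule disjoint_ends_reflect[OF P'(4), of id _ kn]) (use mapk in \<open>simp_all add: C_def
          E_def\<close>)
    have endsC: "sources C = \<sigma> ` ends E (src P)" "targets C = \<tau> ` ends E (tgt P)"
      by (auto simp: ends_def C_def)
    have \<tau>_ends: "N - \<tau> ` ends E (tgt P) = fst c\<^sub>2 ` {..<j} \<union> \<tau> ` (nodes P - targets P)"
      "fst c\<^sub>2 ` {..<j} \<inter> \<tau> ` (nodes P - targets P) = {}" "inj_on \<tau> (nodes P - targets P)"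
      by (rule complement_free_ends[of "nodes P" "fst g ` targets L" \<tau> N "fst c\<^sub>2 ` {..<j}"
          kn, OF _ _ cN(2) tgtP PS(2) tgtE];
          fact)+
    have \<sigma>_ends: "N - \<sigma> ` ends E (src P) = fst c\<^sub>1 ` {..<i} \<union> \<sigma> ` (nodes P - sources P)"
      "fst c\<^sub>1 ` {..<i} \<inter> \<sigma> ` (nodes P - sources P) = {}" "inj_on \<sigma> (nodes P - sources P)"
      by (rule complement_free_ends[of "nodes P" "fst g ` sources L" \<sigma> N "fst c\<^sub>1 ` {..<i}"
          kn, OF _ _ cN(1) srcP PS(1) srcE];
          fact)+
    have d1: "fst d\<^sub>1 ` {..<n} = \<tau> ` (nodes P - targets P)"
      unfolding P'(7)[symmetric] by (simp add: d\<^sub>1_def image_image)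
    have d2: "fst d\<^sub>2 ` {..<m} = \<sigma> ` (nodes P - sources P)"
      unfolding P'(10)[symmetric] by (simp add: d\<^sub>2_def image_image)
    have nC: "nodes C = N" by (simp add: C_def)
    show "fst (copair j c\<^sub>2 d\<^sub>1) ` {..<j + n} = nodes C - targets C"
      unfolding copair_image d1 endsC nC \<tau>_ends(1) by (rule refl)
    show "fst (copair m d\<^sub>2 c\<^sub>1) ` {..<m + i} = nodes C - sources C"
      unfolding copair_image d2 endsC nC \<sigma>_ends(1) by (rule Un_commute)
    have inj1: "inj_on (fst d\<^sub>1) {..<n}"
      using comp_inj_on[OF P'(6)] \<tau>_ends(3) P'(7) by (simp add: d\<^sub>1_def comp_def)
    have inj2: "inj_on (fst d\<^sub>2) {..<m}"
      using comp_inj_on[OF P'(9)] \<sigma>_ends(3) P'(10) by (simp add: d\<^sub>2_def comp_def)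
    show "inj_on (fst (copair j c\<^sub>2 d\<^sub>1)) {..<j + n}"
      unfolding copair_inj_iff d1 using inj1 \<tau>_ends(2) by (simp add: c\<^sub>2_def inj_on_def)
    show "inj_on (fst (copair m d\<^sub>2 c\<^sub>1)) {..<m + i}"
      unfolding copair_inj_iff d2 using inj2 \<sigma>_ends(2) by (simp add: c\<^sub>1_def inj_on_def Int_commute)
  qed
  moreover have "\<forall>v<n. fst k (fst d\<^sub>1 v) = fst x\<^sub>1 v"
  proof (intro allI impI)
    fix v assume "v < n"
    then have "fst x\<^sub>1 v \<in> nodes P - targets P" unfolding P'(7)[symmetric] by simp
    then have "fst x\<^sub>1 v \<in> nodes P - fst g ` targets L" using tgtP by blast
    then show "fst k (fst d\<^sub>1 v) = fst x\<^sub>1 v" using \<tau>(1) by (simp add: k_def d\<^sub>1_def)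
  qed
  moreover have "\<forall>v<m. fst k (fst d\<^sub>2 v) = fst x\<^sub>2 v"
  proof (intro allI impI)
    fix v assume "v < m"
    then have "fst x\<^sub>2 v \<in> nodes P - sources P" unfolding P'(10)[symmetric] by simp
    then have "fst x\<^sub>2 v \<in> nodes P - fst g ` sources L" using srcP by blast
    then show "fst k (fst d\<^sub>2 v) = fst x\<^sub>2 v" using \<sigma>(1) by (simp add: k_def d\<^sub>2_def)
  qed
  ultimately show ?thesis using that by blast
qed

text \<open>The explicit gluing is returned with the step because comparing contexts needs the
  covering and injectivity facts it records.\<close>

lemma convex_step_exists:
  assumes r: "ma_rule S r" and X: "ma_ihypergraph S X" and g: "convex_match (lhs r) (carrier X) g"
  obtains Y t where "convex_step_by S r X Y t" "mtch t = g"
    "gluing (rule_i r + rule_j r) (lhs r) (ctxt t) (carrier X)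
       (copair (rule_i r) (lhs_i r) (lhs_j r)) (ctxt_rule r t) g (ctxt_left t)"
proof -
  let ?i = "rule_i r" and ?j = "rule_j r" and ?n = "dom_size X" and ?m = "cod_size X" and ?P =
      "carrier X"
  have L: "ma_cospan S ?i (lhs_i r) (lhs r) (lhs_j r) ?j"
      and R: "ma_cospan S ?i (rhs_i r) (rhs r) (rhs_j r) ?j"
    using r by (simp_all add: ma_rule_def)
  have P: "ma_cospan S ?n (dom_leg X) ?P (cod_leg X) ?m" using X by (simp add: ma_ihypergraph_def)
  have hg: "hom (lhs r) ?P g" "mono_mor (lhs r) g"
    and convex: "\<And>v w e s t. v \<in> fst g ` nodes (lhs r) \<Longrightarrow> w \<in> fst g ` nodes (lhs r) \<Longrightarrow> e \<in> edges ?P \<Longrightarrow>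
      s \<in> set (src ?P e) \<Longrightarrow> t \<in> set (tgt ?P e) \<Longrightarrow> (v, s) \<in> (arcs ?P)\<^sup>* \<Longrightarrow> (t, w) \<in> (arcs ?P)\<^sup>* \<Longrightarrow>
      e \<in> snd g ` edges (lhs r)"
    using g unfolding convex_match_iff by blast+
  obtain C c\<^sub>1 c\<^sub>2 d\<^sub>1 d\<^sub>2 k where
    gl: "gluing (?i + ?j) (lhs r) C ?P (copair ?i (lhs_i r) (lhs_j r)) (copair ?i c\<^sub>1 c\<^sub>2) g k"
    and mono: "inj_on (fst (copair ?i c\<^sub>1 c\<^sub>2)) {..<?i + ?j}"
    and C: "ma_cospan S (?j + ?n) (copair ?j c\<^sub>2 d\<^sub>1) C (copair ?m d\<^sub>2 c\<^sub>1) (?m + ?i)"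
    and d: "\<forall>v<?n. fst k (fst d\<^sub>1 v) = fst (dom_leg X) v"
        "\<forall>v<?m. fst k (fst d\<^sub>2 v) = fst (cod_leg X) v"
    by (rule boundary_complement_exists[OF L P hg])
  note L' = ma_cospanD[OF L] and R' = ma_cospanD[OF R] and C' = ma_cospanD[OF C]
      and P' = ma_cospanD[OF P]
  have cin: "fst c\<^sub>1 ` {..<?i} \<subseteq> nodes C" "fst d\<^sub>2 ` {..<?m} \<subseteq> nodes C"
    "fst c\<^sub>2 ` {..<?j} \<subseteq> nodes C" "fst d\<^sub>1 ` {..<?n} \<subseteq> nodes C"
    using C'(7,10) unfolding copair_image by blast+
  have hom_copair: "hom (disc (p + q)) G (copair p f f')"
    if "\<And>a. a < p \<Longrightarrow> fst f a \<in> nodes G" "\<And>a. a < q \<Longrightarrow> fst f' a \<in> nodes G" for p q f f' and G ::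
        "'a hypergraph"
    unfolding hom_disc_iff fst_copair using that by auto
  have hc: "hom (disc (?i + ?j)) C (copair ?i c\<^sub>1 c\<^sub>2)" "hom (disc (?n + ?m)) C (copair ?n d\<^sub>1 d\<^sub>2)"
    by (rule hom_copair; use cin in \<open>simp add: image_subset_iff\<close>)+
  have hL: "hom (disc (?i + ?j)) (lhs r) (copair ?i (lhs_i r) (lhs_j r))"
    by (rule hom_copair) (use L'(5,8) in \<open>simp_all add: hom_disc_iff\<close>)
  have hR: "hom (disc (?i + ?j)) (rhs r) (copair ?i (rhs_i r) (rhs_j r))"
    by (rule hom_copair) (use R'(5,8) in \<open>simp_all add: hom_disc_iff\<close>)
  obtain D h k' where D: "hypergraph S D"
    and gr: "gluing (?i + ?j) (rhs r) C D (copair ?i (rhs_i r) (rhs_j r)) (copair ?i c\<^sub>1 c\<^sub>2) h k'"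
    by (rule gluing_exists[OF R'(1) C'(1) hR hc(1) mono])
  have kC: "hom C ?P k" and kdis: "snd g ` edges (lhs r) \<inter> snd k ` edges C = {}"
    using gl by (simp_all add: gluing_def)
  \<comment> \<open>The first edge of such a path lies, in the host, on a path between match nodes.
    Convexity puts it into the image of the match, from which context edges are disjoint.\<close>
  have nopath: "(fst c\<^sub>2 b, fst c\<^sub>1 a) \<notin> (arcs C)\<^sup>+" if ab: "a < ?i" "b < ?j" for a b
  proof
    assume "(fst c\<^sub>2 b, fst c\<^sub>1 a) \<in> (arcs C)\<^sup>+"
    then obtain u where u: "(fst c\<^sub>2 b, u) \<in> arcs C" "(u, fst c\<^sub>1 a) \<in> (arcs C)\<^sup>*"
        by (meson tranclD)
    then obtain e where e: "e \<in> edges C" "fst c\<^sub>2 b \<in> set (src C e)" "u \<in> set (tgt C e)"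
      unfolding arcs_def by blast
    note kc = gluing_inj_on(3,4)[OF gl L'(5,8,6,9)]
    have ends: "fst k (fst c\<^sub>2 b) \<in> fst g ` nodes (lhs r)"
        "fst k (fst c\<^sub>1 a) \<in> fst g ` nodes (lhs r)"
      using kc ab L'(5,8) by (simp_all add: hom_disc_iff)
    have "snd k e \<in> snd g ` edges (lhs r)"
    proof (rule convex[OF ends])
      show "snd k e \<in> edges ?P" using homD(2)[OF kC e(1)] .
      show "fst k (fst c\<^sub>2 b) \<in> set (src ?P (snd k e))" "fst k u \<in> set (tgt ?P (snd k e))"
        using homD(4,5)[OF kC e(1)] e by simp_all
      show "(fst k u, fst k (fst c\<^sub>1 a)) \<in> (arcs ?P)\<^sup>*" by (rule hom_arcs_rtrancl[OF kC u(2)])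
    qed simp
    then show False using kdis e(1) by blast
  qed
  define Y where "Y = \<lparr> carrier = D, dom_size = ?n, cod_size = ?m, dom_leg = k' \<odot> d\<^sub>1, cod_leg =
      k' \<odot> d\<^sub>2 \<rparr>"
  define t where "t = \<lparr> ctxt = C, ctxt_i = c\<^sub>1, ctxt_j = c\<^sub>2, ctxt_dom = d\<^sub>1, ctxt_cod =
      d\<^sub>2, mtch = g,
    ctxt_left = k, comtch = h, ctxt_right = k' \<rparr>"
  have Y: "ma_ihypergraph S Y"
    using gluing_ma_cospan[OF R C mono D gr nopath] by (simp add: ma_ihypergraph_def Y_def)
  have "dpo_step S r X Y t"
    unfolding dpo_step_def
  proof (intro conjI)
    show "dom_size Y = ?n" "cod_size Y = ?m" by (simp_all add: Y_def)
    show "pushout S (disc (?i + ?j)) (lhs r) (ctxt t) ?P (copair ?i (lhs_i r) (lhs_j r))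
        (ctxt_rule r t)
      (mtch t) (ctxt_left t)"
      using gluing_pushout[OF L'(1) C'(1) P'(1) hL hc(1) gl] by (simp add: t_def ctxt_rule_def)
    show "pushout S (disc (?i + ?j)) (rhs r) (ctxt t) (carrier Y) (copair ?i (rhs_i r) (rhs_j r))
        (ctxt_rule r t)
      (comtch t) (ctxt_right t)"
      using gluing_pushout[OF R'(1) C'(1) D hR hc(1) gr] by (simp add: t_def ctxt_rule_def Y_def)
    show "hom (disc (?n + ?m)) (ctxt t) (ctxt_interface X t)"
      using hc(2) by (simp add: t_def ctxt_interface_def)
    show "mor_eq (disc (?n + ?m) :: 'a hypergraph) (ctxt_left t \<odot> ctxt_interface X t) (interface X)"
      using d by (auto simp: mor_eq_disc_iff t_def ctxt_interface_def interface_def fst_copair)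
    show "mor_eq (disc (?n + ?m) :: 'a hypergraph) (ctxt_right t \<odot> ctxt_interface X t) (interface
        Y)"
      by (auto simp: mor_eq_disc_iff t_def ctxt_interface_def interface_def fst_copair Y_def)
  qed
  moreover have "boundary_complement S r X t"
    using mono C d
    by (simp add: boundary_complement_def t_def ctxt_rule_def mono_mor_disc_iff mor_eq_disc_iff)
  ultimately have "convex_step_by S r X Y t"
    using X Y g by (simp add: convex_step_by_def t_def)
  then show ?thesis using that[of Y t] gl by (simp add: t_def ctxt_rule_def)
qed

text \<open>
  The inclusion \<open>q\<close> of the old boundary complement into the new one is forced by
  \<open>ctxt_left t' \<odot> q = p \<odot> ctxt_left t\<close> away from the boundary.  It is a morphism because \<open>ctxt_left t'\<close> is injective on the nodes
  that can be sources and on those that can be targets.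
\<close>

lemma boundary_complement_context_along:
  assumes r: "ma_rule S r" and t: "dpo_step S r X Y t"
    and bc: "boundary_complement S r X (t\<lparr>ctxt_dom := d\<^sub>1, ctxt_cod := d\<^sub>2\<rparr>)"
    and p: "hom (carrier X) (carrier X') p" "mono_mor (carrier X) p"
    and t': "convex_step_by S r X' Y' t'" and m: "mtch t' = p \<odot> mtch t"
    and gl: "gluing (rule_i r + rule_j r) (lhs r) (ctxt t') (carrier X')
       (copair (rule_i r) (lhs_i r) (lhs_j r)) (ctxt_rule r t') (p \<odot> mtch t) (ctxt_left t')"
  shows "context_along S r (carrier X) (carrier X') p t t'"
proof -
  let ?i = "rule_i r" and ?j = "rule_j r" and ?G = "carrier X" and ?P = "carrier X'"
    and ?C = "ctxt t" and ?C' = "ctxt t'" and ?c = "ctxt_rule r t" and ?c' = "ctxt_rule r t'"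
    and ?g = "ctxt_left t" and ?g' = "ctxt_left t'" and ?f = "mtch t" and ?l =
        "copair (rule_i r) (lhs_i r) (lhs_j r)"
  have L: "ma_cospan S ?i (lhs_i r) (lhs r) (lhs_j r) ?j" using r by (simp add: ma_rule_def)
  note L' = ma_cospanD[OF L]
  have po: "pushout S (disc (?i + ?j)) (lhs r) ?C ?G ?l ?c ?f ?g"
    using t by (simp add: dpo_step_def)
  have po': "pushout S (disc (?i + ?j)) (lhs r) ?C' ?P ?l ?c' (p \<odot> ?f) ?g'"
    using t' m by (simp add: convex_step_by_def dpo_step_def)
  have bc': "boundary_complement S r X' t'" using t' by (simp add: convex_step_by_def)
  have c: "inj_on (fst ?c) {..<?i + ?j}" and c': "inj_on (fst ?c') {..<?i + ?j}"
    using bc bc' by (simp_all add: boundary_complement_def mono_mor_disc_iff ctxt_rule_def)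
  have C: "ma_cospan S (?j + dom_size X) (copair ?j (ctxt_j t) d\<^sub>1) ?C (copair (cod_size X) d\<^sub>2
      (ctxt_i t)) (cod_size X + ?i)"
    using bc by (simp add: boundary_complement_def)
  have C': "ma_cospan S (?j + dom_size X') (copair ?j (ctxt_j t') (ctxt_dom t')) ?C'
      (copair (cod_size X') (ctxt_cod t') (ctxt_i t')) (cod_size X' + ?i)"
    using bc' by (simp add: boundary_complement_def)
  have free: "U \<inter> Z = {} \<and> V \<inter> Z = {}" if "U \<union> V = N - Z" for U V N Z :: "nat set" using that
      by blast
  have bnd: "fst (ctxt_i t) ` {..<?i} \<inter> sources ?C = {}"
      "fst (ctxt_j t) ` {..<?j} \<inter> targets ?C = {}"
    using free[OF ma_cospanD(10)[OF C, unfolded copair_image]] free[OF ma_cospanD(7)[OF C,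
        unfolded copair_image]]
    by simp_all
  have bnd': "fst (ctxt_i t') ` {..<?i} \<inter> sources ?C' = {}"
      "fst (ctxt_j t') ` {..<?j} \<inter> targets ?C' = {}"
    using free[OF ma_cospanD(10)[OF C', unfolded copair_image]] free[OF ma_cospanD(7)[OF C',
        unfolded copair_image]]
    by simp_all
  have hC: "hypergraph S ?C" and hC': "hypergraph S ?C'" and hom_g: "hom ?C ?G ?g"
      and hom_g': "hom ?C' ?P ?g'"
    and hom_c: "hom (disc (?i + ?j)) ?C ?c" and hom_c': "hom (disc (?i + ?j)) ?C' ?c'"
        and hom_f: "hom (lhs r) ?G ?f"
    and comm: "\<And>a. a < ?i + ?j \<Longrightarrow> fst ?f (fst ?l a) = fst ?g (fst ?c a)"
    and comm': "\<And>a. a < ?i + ?j \<Longrightarrow> fst p (fst ?f (fst ?l a)) = fst ?g' (fst ?c' a)"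
    using po po' by (simp_all add: pushout_def mor_eq_disc_iff)
  let ?B = "fst ?c ` {..<?i + ?j}" and ?B' = "fst ?c' ` {..<?i + ?j}"
  let ?N' = "nodes ?C' - ?B'"
  have nP: "nodes ?P = fst (p \<odot> ?f) ` nodes (lhs r) \<union> fst ?g' ` ?N'"
    and eP: "edges ?P = snd (p \<odot> ?f) ` edges (lhs r) \<union> snd ?g' ` edges ?C'"
    using gl by (simp_all add: gluing_def)
  have g'inj: "inj_on (fst ?g') (nodes ?C' - fst (ctxt_i t') ` {..<?i})"
    "inj_on (fst ?g') (nodes ?C' - fst (ctxt_j t') ` {..<?j})"
    using gluing_inj_on(1,2)[OF gl[unfolded ctxt_rule_def] L'(5,8,6,9)] .
  \<comment> \<open>On the boundary the value is forced by the gluing maps of the rule; there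
    \<open>ctxt_left t'\<close> may merge two nodes and could not determine it.\<close>
  define qn where "qn v = (if v \<in> ?B then fst ?c' (inv_into {..<?i + ?j} (fst ?c) v)
      else inv_into ?N' (fst ?g') (fst p (fst ?g v)))" for v
  define qe where "qe e = inv_into (edges ?C') (snd ?g') (snd p (snd ?g e))" for e
  have qc: "qn (fst ?c a) = fst ?c' a" if "a < ?i + ?j" for a
    using that c by (simp add: qn_def)
  have qN: "qn v \<in> ?N' \<and> fst ?g' (qn v) = fst p (fst ?g v)" if v: "v \<in> nodes ?C - ?B" for v
  proof -
    have g: "fst ?g v \<in> nodes ?G" using homD(1)[OF hom_g] v by blast
    have "fst ?g v \<notin> fst ?f ` nodes (lhs r)" using pushout_disjoint(1)[OF po c v] .
    then have "fst p (fst ?g v) \<notin> fst (p \<odot> ?f) ` nodes (lhs r)"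
      using p(2) g homD(1)[OF hom_f] by (auto simp: mono_mor_def inj_on_eq_iff)
    moreover have "fst p (fst ?g v) \<in> nodes ?P" using homD(1)[OF p(1) g] .
    ultimately have *: "fst p (fst ?g v) \<in> fst ?g' ` ?N'" unfolding nP by blast
    have "qn v = inv_into ?N' (fst ?g') (fst p (fst ?g v))" unfolding qn_def using v
        by (simp only: Diff_iff if_False)
    then show ?thesis using inv_into_into[OF *] f_inv_into_f[OF *] by (simp only:)
  qed
  have qE: "qe e \<in> edges ?C' \<and> snd ?g' (qe e) = snd p (snd ?g e)" if e: "e \<in> edges ?C" for e
  proof -
    have g: "snd ?g e \<in> edges ?G" using homD(2)[OF hom_g] e by blast
    have "snd ?g e \<notin> snd ?f ` edges (lhs r)" using pushout_disjoint(2)[OF po c e] .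
    then have "snd p (snd ?g e) \<notin> snd (p \<odot> ?f) ` edges (lhs r)"
      using p(2) g homD(2)[OF hom_f] by (auto simp: mono_mor_def inj_on_eq_iff)
    moreover have "snd p (snd ?g e) \<in> edges ?P" using homD(2)[OF p(1) g] .
    ultimately have *: "snd p (snd ?g e) \<in> snd ?g' ` edges ?C'" unfolding eP by blast
    then show ?thesis unfolding qe_def using inv_into_into[OF *] f_inv_into_f[OF *] by simp
  qed
  have qn: "qn v \<in> nodes ?C' \<and> fst ?g' (qn v) = fst p (fst ?g v)" if v: "v \<in> nodes ?C" for v
  proof (cases "v \<in> ?B")
    case True
    then obtain a where a: "a < ?i + ?j" "v = fst ?c a" by auto
    then show ?thesis using qc comm[OF a(1)] comm'[OF a(1)] hom_c' by (simp add: hom_disc_iff)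
  next
    case False
    then show ?thesis using qN v by blast
  qed
  have B: "?B = fst (ctxt_i t) ` {..<?i} \<union> fst (ctxt_j t) ` {..<?j}"
    "?B' = fst (ctxt_i t') ` {..<?i} \<union> fst (ctxt_j t') ` {..<?j}"
    "fst (ctxt_i t') ` {..<?i} \<inter> fst (ctxt_j t') ` {..<?j} = {}"
    using c' unfolding ctxt_rule_def copair_image copair_inj_iff by simp_all
  have qi: "qn (fst (ctxt_i t) a) = fst (ctxt_i t') a" if "a < ?i" for a
    using qc[of a] that by (simp add: ctxt_rule_def fst_copair)
  have qj: "qn (fst (ctxt_j t) b) = fst (ctxt_j t') b" if "b < ?j" for b
    using qc[of "?i + b"] that by (simp add: ctxt_rule_def fst_copair)
  \<comment> \<open>\<open>qn\<close> keeps the halves of the boundary apart and interior nodes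
    interior. So images of sources stay off the \<open>i\<close> half, where
    \<open>ctxt_left t'\<close> is injective; \<open>q_off'\<close> does the same for targets and
    the \<open>j\<close> half.\<close>
  have q_off: "qn v \<notin> fst (ctxt_i t') ` {..<?i}" if v: "v \<in> nodes ?C"
      "v \<notin> fst (ctxt_i t) ` {..<?i}" for v
  proof (cases "v \<in> ?B")
    case True
    then obtain b where "b < ?j" "v = fst (ctxt_j t) b" using B(1) v(2) by auto
    then have "qn v \<in> fst (ctxt_j t') ` {..<?j}" using qj by simp
    then show ?thesis using B(3) by blast
  next
    case False
    then show ?thesis using qN[of v] v(1) B(2) by blast
  qed
  have q_off': "qn v \<notin> fst (ctxt_j t') ` {..<?j}" if v: "v \<in> nodes ?C"
      "v \<notin> fst (ctxt_j t) ` {..<?j}" for v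
  proof (cases "v \<in> ?B")
    case True
    then obtain a where "a < ?i" "v = fst (ctxt_i t) a" using B(1) v(2) by auto
    then have "qn v \<in> fst (ctxt_i t') ` {..<?i}" using qi by simp
    then show ?thesis using B(3) by blast
  next
    case False
    then show ?thesis using qN[of v] v(1) B(2) by blast
  qed
  have "hom ?C ?C' (qn, qe)"
    unfolding hom_def
  proof (intro conjI ballI)
    show "fst (qn, qe) ` nodes ?C \<subseteq> nodes ?C'" using qn by auto
    show "snd (qn, qe) ` edges ?C \<subseteq> edges ?C'" using qE by auto
    fix e assume e: "e \<in> edges ?C"
    have g: "snd ?g e \<in> edges ?G" using homD(2)[OF hom_g e] .
    note q = conjunct1[OF qE[OF e]] conjunct2[OF qE[OF e]]
    show "lab ?C' (snd (qn, qe) e) = lab ?C e"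
      using homD(3)[OF hom_g' q(1)] homD(3)[OF p(1) g] homD(3)[OF hom_g e] q(2) by simp
    have sub: "set (src ?C e) \<subseteq> nodes ?C" "set (tgt ?C e) \<subseteq> nodes ?C"
      and sub': "set (src ?C' (qe e)) \<subseteq> nodes ?C'" "set (tgt ?C' (qe e)) \<subseteq> nodes ?C'"
      using hC hC' e q(1) by (simp_all add: hypergraph_def)
    have nb: "v \<notin> fst (ctxt_i t) ` {..<?i}" if "v \<in> set (src ?C e)" for v
      using that e bnd(1) unfolding ends_def by blast
    have nb': "v \<notin> fst (ctxt_j t) ` {..<?j}" if "v \<in> set (tgt ?C e)" for v
      using that e bnd(2) unfolding ends_def by blast
    have nc: "v \<notin> fst (ctxt_i t') ` {..<?i}" if "v \<in> set (src ?C' (qe e))" for v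
      using that q(1) bnd'(1) unfolding ends_def by blast
    have nc': "v \<notin> fst (ctxt_j t') ` {..<?j}" if "v \<in> set (tgt ?C' (qe e))" for v
      using that q(1) bnd'(2) unfolding ends_def by blast
    \<comment> \<open>The two candidate source lists agree after \<open>ctxt_left t'\<close>, which
      can then be cancelled.\<close>
    have "map (fst ?g') (map qn (src ?C e)) = map (fst p) (map (fst ?g) (src ?C e))"
      unfolding map_map by (rule map_cong[OF refl]) (use qn sub(1) in auto)
    also have "\<dots> = map (fst ?g') (src ?C' (qe e))"
      unfolding homD(4)[OF hom_g e, symmetric] homD(4)[OF p(1) g, symmetric]
        homD(4)[OF hom_g' q(1), symmetric] q(2) by (rule refl)
    finally have "map (fst ?g') (src ?C' (qe e)) = map (fst ?g') (map qn (src ?C e))" by (rule sym)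
    moreover have "set (src ?C' (qe e)) \<union> set (map qn (src ?C e)) \<subseteq> nodes ?C' - fst (ctxt_i t') `
        {..<?i}"
    proof
      fix v assume "v \<in> set (src ?C' (qe e)) \<union> set (map qn (src ?C e))"
      then consider "v \<in> set (src ?C' (qe e))" | w where "w \<in> set (src ?C e)" "v = qn w" by auto
      then show "v \<in> nodes ?C' - fst (ctxt_i t') ` {..<?i}"
      proof cases
        case 1
        show ?thesis using nc[OF 1] subsetD[OF sub'(1) 1] by simp
      next
        case 2
        have w: "w \<in> nodes ?C" using subsetD[OF sub(1) 2(1)] .
        show ?thesis using qn[OF w] q_off[OF w nb[OF 2(1)]] 2(2) by simp
      qed
    qed
    ultimately show "src ?C' (snd (qn, qe) e) = map (fst (qn, qe)) (src ?C e)"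
      unfolding fst_conv snd_conv by (rule map_inj_on[OF _ inj_on_subset[OF g'inj(1)]])
    have "map (fst ?g') (map qn (tgt ?C e)) = map (fst p) (map (fst ?g) (tgt ?C e))"
      unfolding map_map by (rule map_cong[OF refl]) (use qn sub(2) in auto)
    also have "\<dots> = map (fst ?g') (tgt ?C' (qe e))"
      unfolding homD(5)[OF hom_g e, symmetric] homD(5)[OF p(1) g, symmetric]
        homD(5)[OF hom_g' q(1), symmetric] q(2) by (rule refl)
    finally have "map (fst ?g') (tgt ?C' (qe e)) = map (fst ?g') (map qn (tgt ?C e))" by (rule sym)
    moreover have "set (tgt ?C' (qe e)) \<union> set (map qn (tgt ?C e)) \<subseteq> nodes ?C' - fst (ctxt_j t') `
        {..<?j}"
    proof
      fix v assume "v \<in> set (tgt ?C' (qe e)) \<union> set (map qn (tgt ?C e))"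
      then consider "v \<in> set (tgt ?C' (qe e))" | w where "w \<in> set (tgt ?C e)" "v = qn w" by auto
      then show "v \<in> nodes ?C' - fst (ctxt_j t') ` {..<?j}"
      proof cases
        case 1
        show ?thesis using nc'[OF 1] subsetD[OF sub'(2) 1] by simp
      next
        case 2
        have w: "w \<in> nodes ?C" using subsetD[OF sub(2) 2(1)] .
        show ?thesis using qn[OF w] q_off'[OF w nb'[OF 2(1)]] 2(2) by simp
      qed
    qed
    ultimately show "tgt ?C' (snd (qn, qe) e) = map (fst (qn, qe)) (tgt ?C e)"
      unfolding fst_conv snd_conv by (rule map_inj_on[OF _ inj_on_subset[OF g'inj(2)]])
  qed
  moreover have cq: "mor_eq (disc (?i + ?j) :: 'a hypergraph) ?c' ((qn, qe) \<odot> ?c)"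
    using qc by (simp add: mor_eq_disc_iff)
  moreover have "mor_eq ?C (p \<odot> ?g) (?g' \<odot> (qn, qe))"
    using qn qE by (simp add: mor_eq_def)
  ultimately have "pushout S ?C ?G ?C' ?P ?g (qn, qe) p ?g'"
    using pushout_cancel[OF po po' p(1)] by blast
  then show ?thesis unfolding context_along_def using cq by blast
qed

section \<open>Path extensions\<close>

text \<open>
  For every pair \<open>(y, x)\<close> of the relation there is one \<open>Fork\<close> and one \<open>Join\<close>, linked by the node
  \<open>Mid y x\<close>.  The forks of an output \<open>y\<close> form a chain starting at \<open>y\<close>, ordered by \<open>x\<close>, and the joins
  of an input \<open>x\<close> form a chain ending at \<open>x\<close>, ordered by \<open>y\<close>.  The last fork of each chain leaves
  a dangling output \<open>Fork_Out y x\<close> and the first join of each chain a dangling input \<open>Join_In y x\<close>.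
\<close>

datatype ext_node = Old nat | Fork_Out nat nat | Mid nat nat | Join_In nat nat

datatype ext_edge = Old_Edge nat | Fork_Edge nat nat | Join_Edge nat nat

instance ext_node :: countable by countable_datatype
instance ext_edge :: countable by countable_datatype

text \<open>The previous member of a chain; \<open>None\<close> marks the member attached directly
  to an old node. The maximum ranges over numbers below \<open>x\<close>, hence over a finite
  set.\<close>

definition pred_in :: "nat set \<Rightarrow> nat \<Rightarrow> nat option" where
  "pred_in A x = (if {z \<in> A. z < x} = {} then None else Some (Max {z \<in> A. z < x}))"

lemma pred_in_Some:
  assumes "pred_in A x = Some z"
  shows "z \<in> A" "z < x"
proof -
  have "{z \<in> A. z < x} \<noteq> {}" "z = Max {z \<in> A. z < x}"
    using assms by (auto simp: pred_in_def split: if_splits)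
  then have "z \<in> {z \<in> A. z < x}" using Max_in[of "{z \<in> A. z < x}"] by simp
  then show "z \<in> A" "z < x" by simp_all
qed

lemma pred_in_less:
  assumes "x \<in> A" "x < x'"
  shows "\<exists>z\<ge>x. pred_in A x' = Some z"
proof -
  have "x \<in> {z \<in> A. z < x'}" using assms by simp
  then have "{z \<in> A. z < x'} \<noteq> {}" "x \<le> Max {z \<in> A. z < x'}" by (blast, auto intro: Max_ge)
  then show ?thesis by (simp add: pred_in_def)
qed

text \<open>The predecessor of the larger element is at least the smaller one, while that of the
  smaller lies strictly below it.\<close>

lemma pred_in_inj:
  assumes "x \<in> A" "x' \<in> A" "pred_in A x = pred_in A x'"
  shows "x = x'"
proof -
  have False if ab: "a \<in> A" "a < b" "pred_in A a = pred_in A b" for a b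
  proof -
    obtain z where "z \<ge> a" "pred_in A a = Some z" using pred_in_less[OF ab(1,2)] ab(3) by auto
    then show False using pred_in_Some(2) by fastforce
  qed
  then show ?thesis using assms by (metis linorder_neqE_nat)
qed

text \<open>The form suited to case analysis on edges: no repetition within a list and no overlap
  between lists, without positions.\<close>

lemma disjoint_ends_iff:
  "disjoint_ends E s \<longleftrightarrow> (\<forall>e\<in>E. distinct (s e)) \<and> (\<forall>e\<in>E. \<forall>e'\<in>E. e \<noteq> e' \<longrightarrow> set (s e) \<inter> set (s e') = {})"
proof
  assume *: "disjoint_ends E s"
  have "distinct (s e)" if "e \<in> E" for e
    unfolding distinct_conv_nth using disjoint_endsD(2)[OF * that that] by blast
  then show "(\<forall>e\<in>E. distinct (s e)) \<and> (\<forall>e\<in>E. \<forall>e'\<in>E. e \<noteq> e' \<longrightarrow> set (s e) \<inter> set (s e') = {})"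
    using disjoint_endsD_set[OF *] by blast
next
  assume *: "(\<forall>e\<in>E. distinct (s e)) \<and> (\<forall>e\<in>E. \<forall>e'\<in>E. e \<noteq> e' \<longrightarrow> set (s e) \<inter> set (s e') = {})"
  show "disjoint_ends E s"
  proof (rule disjoint_endsI)
    fix e k e' k'
    assume a: "e \<in> E" "e' \<in> E" "k < length (s e)" "k' < length (s e')" "s e ! k = s e' ! k'"
    then have "s e ! k \<in> set (s e) \<inter> set (s e')" by (metis IntI nth_mem)
    then have "e = e'" using * a by blast
    then show "e = e' \<and> k = k'" using * a by (simp add: nth_eq_iff_index_eq)
  qed
qed

section \<open>The extension attached to a realised path relation\<close>

locale realised_path_relation =
  fixes \<Sigma> :: "'s signature" and G H :: "('s + path_gen) hypergraph" and m :: mor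
  assumes ma_G: "ma_hypergraph (ext_sig \<Sigma>) G" and ma_H: "ma_hypergraph (ext_sig \<Sigma>) H"
    and hom_m: "hom G H m" and mono_m: "mono_mor G m"
begin

abbreviation "R \<equiv> path_relation G H m"

definition fork_src :: "nat \<Rightarrow> nat \<Rightarrow> ext_node" where
  "fork_src y x = (case pred_in {x. (y, x) \<in> R} x of None \<Rightarrow> Old y | Some x' \<Rightarrow> Fork_Out y x')"

text \<open>Joins run against the order: the join of the least \<open>y\<close> feeds
  \<open>x\<close>, every other one feeds the free input of its predecessor, and the largest
  \<open>y\<close> keeps the dangling \<open>Join_In\<close>.\<close>

definition join_tgt :: "nat \<Rightarrow> nat \<Rightarrow> ext_node" where
  "join_tgt y x = (case pred_in {y. (y, x) \<in> R} y of None \<Rightarrow> Old x | Some y' \<Rightarrow> Join_In y' x)"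

fun ext_src :: "ext_edge \<Rightarrow> ext_node list" where
  "ext_src (Old_Edge e) = map Old (src G e)"
| "ext_src (Fork_Edge y x) = [fork_src y x]"
| "ext_src (Join_Edge y x) = [Mid y x, Join_In y x]"

fun ext_tgt :: "ext_edge \<Rightarrow> ext_node list" where
  "ext_tgt (Old_Edge e) = map Old (tgt G e)"
| "ext_tgt (Fork_Edge y x) = [Mid y x, Fork_Out y x]"
| "ext_tgt (Join_Edge y x) = [join_tgt y x]"

fun ext_lab :: "ext_edge \<Rightarrow> 's + path_gen" where
  "ext_lab (Old_Edge e) = lab G e"
| "ext_lab (Fork_Edge y x) = Inr Fork"
| "ext_lab (Join_Edge y x) = Inr Join"

definition ext_nodes :: "ext_node set" where
  "ext_nodes = Old ` nodes G \<union> (\<lambda>(y, x). Fork_Out y x) ` R \<union> (\<lambda>(y, x). Mid y x) ` R \<union>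
      (\<lambda>(y, x). Join_In y x) ` R"

definition ext_edges :: "ext_edge set" where
  "ext_edges = Old_Edge ` edges G \<union> (\<lambda>(y, x). Fork_Edge y x) ` R \<union> (\<lambda>(y, x). Join_Edge y x) ` R"

definition ext :: "('s + path_gen) hypergraph" where
  "ext = \<lparr> nodes = to_nat ` ext_nodes, edges = to_nat ` ext_edges,
     src = (\<lambda>e. map to_nat (ext_src (from_nat e))), tgt = (\<lambda>e. map to_nat (ext_tgt (from_nat e))),
     lab = (\<lambda>e. ext_lab (from_nat e)) \<rparr>"

definition emb :: mor where
  "emb = (\<lambda>v. to_nat (Old v), \<lambda>e. to_nat (Old_Edge e))"

lemma ext_simps [simp]:
  "nodes ext = to_nat ` ext_nodes" "edges ext = to_nat ` ext_edges"
  "src ext (to_nat e) = map to_nat (ext_src e)" "tgt ext (to_nat e) = map to_nat (ext_tgt e)"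
  "lab ext (to_nat e) = ext_lab e" for e :: ext_edge
  by (simp_all add: ext_def)

lemma hyper_G: "hypergraph (ext_sig \<Sigma>) G" and hyper_H: "hypergraph (ext_sig \<Sigma>) H"
  using ma_G ma_H by (simp_all add: ma_hypergraph_def)

lemma R_iff: "(y, x) \<in> R \<longleftrightarrow> y \<in> nodes G - sources G \<and> x \<in> nodes G - targets G \<and>
    (fst m y, fst m x) \<in> (arcs H)\<^sup>+"
  unfolding path_relation_def path_from_to_iff outputs_eq[OF hyper_G] inputs_eq[OF hyper_G] by simp

lemma ext_edges_cases:
  assumes "E \<in> ext_edges"
  obtains e where "E = Old_Edge e" "e \<in> edges G"
  | y x where "E = Fork_Edge y x" "(y, x) \<in> R"
  | y x where "E = Join_Edge y x" "(y, x) \<in> R"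
  using assms by (auto simp: ext_edges_def)

lemma fork_src_cases:
  obtains "pred_in {x. (y, x) \<in> R} x = None" "fork_src y x = Old y"
  | x' where "pred_in {x. (y, x) \<in> R} x = Some x'" "fork_src y x = Fork_Out y x'" "(y, x') \<in> R"
      "x' < x"
proof (cases "pred_in {x. (y, x) \<in> R} x")
  case None
  then show ?thesis using that(1) by (simp add: fork_src_def)
next
  case (Some x')
  then show ?thesis using that(2) pred_in_Some[OF Some] by (simp add: fork_src_def)
qed

lemma join_tgt_cases:
  obtains "pred_in {y. (y, x) \<in> R} y = None" "join_tgt y x = Old x"
  | y' where "pred_in {y. (y, x) \<in> R} y = Some y'" "join_tgt y x = Join_In y' x" "(y', x) \<in> R"
      "y' < y"
proof (cases "pred_in {y. (y, x) \<in> R} y")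
  case None
  then show ?thesis using that(1) by (simp add: join_tgt_def)
next
  case (Some y')
  then show ?thesis using that(2) pred_in_Some[OF Some] by (simp add: join_tgt_def)
qed

lemma fork_src_inj:
  assumes "(y, x) \<in> R" "(y', x') \<in> R" "fork_src y x = fork_src y' x'"
  shows "y = y' \<and> x = x'"
proof -
  have "y = y' \<and> pred_in {x. (y, x) \<in> R} x = pred_in {x. (y, x) \<in> R} x'"
    by (rule fork_src_cases[of y x]; rule fork_src_cases[of y' x']) (use assms(3) in auto)
  then show ?thesis using pred_in_inj[of x "{x. (y, x) \<in> R}" x'] assms by auto
qed

lemma join_tgt_inj:
  assumes "(y, x) \<in> R" "(y', x') \<in> R" "join_tgt y x = join_tgt y' x'"
  shows "y = y' \<and> x = x'"
proof -
  have "x = x' \<and> pred_in {y. (y, x) \<in> R} y = pred_in {y. (y, x) \<in> R} y'"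
    by (rule join_tgt_cases[of x y]; rule join_tgt_cases[of x' y']) (use assms(3) in auto)
  then show ?thesis using pred_in_inj[of y "{y. (y, x) \<in> R}" y'] assms by auto
qed

lemma fork_src_node: "(y, x) \<in> R \<Longrightarrow> fork_src y x \<in> ext_nodes"
  by (rule fork_src_cases[of y x]) (auto simp: ext_nodes_def R_iff)

lemma join_tgt_node: "(y, x) \<in> R \<Longrightarrow> join_tgt y x \<in> ext_nodes"
  by (rule join_tgt_cases[of x y]) (auto simp: ext_nodes_def R_iff)

lemma ext_hypergraph: "hypergraph (ext_sig \<Sigma>) ext"
  unfolding hypergraph_def
proof (intro conjI ballI)
  have "finite R"
    by (rule finite_subset[of _ "nodes G \<times> nodes G"])
      (use R_iff hypergraph_ends(3)[OF hyper_G] in auto)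
  then show "finite (nodes ext)" "finite (edges ext)"
    using hypergraph_ends(3,4)[OF hyper_G] by (simp_all add: ext_nodes_def ext_edges_def)
  fix e assume "e \<in> edges ext"
  then obtain E where E: "E \<in> ext_edges" "e = to_nat E" by auto
  have "ext_lab E \<in> gens (ext_sig \<Sigma>) \<and> length (ext_src E) = arity (ext_sig \<Sigma>) (ext_lab E) \<and>
      set (ext_src E) \<subseteq> ext_nodes \<and>
    length (ext_tgt E) = coarity (ext_sig \<Sigma>) (ext_lab E) \<and> set (ext_tgt E) \<subseteq> ext_nodes"
    using E(1)
  proof (cases rule: ext_edges_cases)
    case (1 d)
    then show ?thesis using hyper_G by (auto simp: hypergraph_def ext_nodes_def)
  next
    case (2 y x)
    then show ?thesis using fork_src_node[OF 2(2)] by (force simp: ext_sig_def ext_nodes_def)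
  next
    case (3 y x)
    then show ?thesis using join_tgt_node[OF 3(2)] by (force simp: ext_sig_def ext_nodes_def)
  qed
  then show "lab ext e \<in> gens (ext_sig \<Sigma>)" "length (src ext e) = arity (ext_sig \<Sigma>) (lab ext e)"
    "set (src ext e) \<subseteq> nodes ext" "length (tgt ext e) = coarity (ext_sig \<Sigma>) (lab ext e)"
        "set (tgt ext e) \<subseteq> nodes ext"
    unfolding E(2) by auto
qed

lemma disjoint_ends_encode:
  fixes f :: "ext_edge \<Rightarrow> ext_node list"
  assumes "\<And>E. E \<in> ext_edges \<Longrightarrow> distinct (f E)"
    and "\<And>E E' v. E \<in> ext_edges \<Longrightarrow> E' \<in> ext_edges \<Longrightarrow> v \<in> set (f E) \<Longrightarrow> v \<in> set (f E') \<Longrightarrow> E = E'"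
    and "\<And>E. s (to_nat E) = map to_nat (f E)"
  shows "disjoint_ends (to_nat ` ext_edges) s"
  unfolding disjoint_ends_iff
proof (intro conjI ballI impI)
  fix e assume "e \<in> to_nat ` ext_edges"
  then show "distinct (s e)" using assms(1,3) by (auto simp: distinct_map)
next
  fix e e' assume "e \<in> to_nat ` ext_edges" "e' \<in> to_nat ` ext_edges" "e \<noteq> e'"
  then obtain E E' where E: "E \<in> ext_edges" "E' \<in> ext_edges" "e = to_nat E" "e' = to_nat E'"
      "E \<noteq> E'" by auto
  then have "set (f E) \<inter> set (f E') = {}" using assms(2) by blast
  then show "set (s e) \<inter> set (s e') = {}" using E assms(3) by auto
qed

lemma ext_disjoint_sources: "disjoint_ends (edges ext) (src ext)"
  unfolding ext_simps(2)
proof (rule disjoint_ends_encode)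
  have G: "disjoint_ends (edges G) (src G)" using ma_G by (simp add: ma_hypergraph_iff)
  fix E assume E: "E \<in> ext_edges"
  then show "distinct (ext_src E)"
    by (cases rule: ext_edges_cases) (use G in \<open>simp_all add: distinct_map inj_on_def
        disjoint_ends_iff\<close>)
  \<comment> \<open>The first fork of a chain hangs on an output of \<open>G\<close>, which is the
    source of no old edge.\<close>
  have old: False if "v \<in> set (src G e)" "e \<in> edges G" "fork_src y x = Old v" "(y, x) \<in> R"
      for v e y x
  proof -
    have "v \<in> sources G" using that unfolding ends_def by blast
    then show False by (rule_tac fork_src_cases[of y x]) (use that R_iff in auto)
  qed
  have fork: "fork_src y x \<noteq> Mid a b" "fork_src y x \<noteq> Join_In a b" for y x a b
    by (rule fork_src_cases[of y x]; simp)+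
  fix E' v assume E': "E' \<in> ext_edges" and v: "v \<in> set (ext_src E)" "v \<in> set (ext_src E')"
  from E show "E = E'"
  proof (cases rule: ext_edges_cases)
    case (1 e)
    from E' show ?thesis
      by (cases rule: ext_edges_cases) (use 1 v old disjoint_endsD_set[OF G] in auto)
  next
    case (2 y x)
    from E' show ?thesis
      by (cases rule: ext_edges_cases) (use 2 v old fork_src_inj fork in auto)
  next
    case (3 y x)
    from E' show ?thesis
      by (cases rule: ext_edges_cases) (use 3 v fork in \<open>auto dest: sym\<close>)
  qed
qed simp

lemma ext_disjoint_targets: "disjoint_ends (edges ext) (tgt ext)"
  unfolding ext_simps(2)
proof (rule disjoint_ends_encode)
  have G: "disjoint_ends (edges G) (tgt G)" using ma_G by (simp add: ma_hypergraph_iff)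
  fix E assume E: "E \<in> ext_edges"
  then show "distinct (ext_tgt E)"
    by (cases rule: ext_edges_cases) (use G in \<open>simp_all add: distinct_map inj_on_def
        disjoint_ends_iff\<close>)
  have old: False if "v \<in> set (tgt G e)" "e \<in> edges G" "join_tgt y x = Old v" "(y, x) \<in> R"
      for v e y x
  proof -
    have "v \<in> targets G" using that unfolding ends_def by blast
    then show False by (rule_tac join_tgt_cases[of x y]) (use that R_iff in auto)
  qed
  have join: "join_tgt y x \<noteq> Mid a b" "join_tgt y x \<noteq> Fork_Out a b" for y x a b
    by (rule join_tgt_cases[of x y]; simp)+
  fix E' v assume E': "E' \<in> ext_edges" and v: "v \<in> set (ext_tgt E)" "v \<in> set (ext_tgt E')"
  from E show "E = E'"
  proof (cases rule: ext_edges_cases)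
    case (1 e)
    from E' show ?thesis
      by (cases rule: ext_edges_cases) (use 1 v old disjoint_endsD_set[OF G] in auto)
  next
    case (2 y x)
    from E' show ?thesis
      by (cases rule: ext_edges_cases) (use 2 v join in \<open>auto dest: sym\<close>)
  next
    case (3 y x)
    from E' show ?thesis
      by (cases rule: ext_edges_cases) (use 3 v old join_tgt_inj join in auto)
  qed
qed simp

text \<open>
  Every arc of the extension is increasing for the lexicographic order that compares first the
  anchors in \<open>H\<close> by reachability and then the heights.  Acyclicity, the path relation and the
  convexity of matches are all inherited from \<open>H\<close> through this order.
\<close>

fun anchor :: "ext_node \<Rightarrow> nat" where
  "anchor (Old v) = fst m v"
| "anchor (Fork_Out y x) = fst m y"
| "anchor (Mid y x) = fst m y"
| "anchor (Join_In y x) = fst m x"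

text \<open>Heights climb from 0 along the forks and climb to 0 along the joins. The offset 1 keeps
  the added nodes away from height 0 even for the node number 0.\<close>

fun height :: "ext_node \<Rightarrow> int" where
  "height (Old v) = 0"
| "height (Fork_Out y x) = 1 + int x"
| "height (Mid y x) = 1 + int x"
| "height (Join_In y x) = - 1 - int y"

definition increasing :: "(nat \<times> nat) set" where
  "increasing = {(s, t). (anchor (from_nat s), anchor (from_nat t)) \<in> (arcs H)\<^sup>+ \<or>
     anchor (from_nat s) = anchor (from_nat t) \<and> height (from_nat s) < height (from_nat t)}"

lemma increasing_iff: "(to_nat s, to_nat t) \<in> increasing \<longleftrightarrow>
    (anchor s, anchor t) \<in> (arcs H)\<^sup>+ \<or> anchor s = anchor t \<and> height s < height t"
  by (simp add: increasing_def)

lemma trans_increasing: "trans increasing"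
  unfolding increasing_def by (rule transI) (auto intro: trancl_trans)

lemma fork_src_anchor [simp]: "anchor (fork_src y x) = fst m y"
  by (rule fork_src_cases[of y x]) auto

lemma fork_src_height: "height (fork_src y x) < 1 + int x"
  by (rule fork_src_cases[of y x]) auto

lemma join_tgt_anchor [simp]: "anchor (join_tgt y x) = fst m x"
  by (rule join_tgt_cases[of x y]) auto

lemma join_tgt_height: "- 1 - int y < height (join_tgt y x)"
  by (rule join_tgt_cases[of x y]) auto

lemma arcs_ext_increasing: "arcs ext \<subseteq> increasing"
proof (rule subrelI)
  fix s t assume "(s, t) \<in> arcs ext"
  then obtain e where "e \<in> edges ext" "s \<in> set (src ext e)" "t \<in> set (tgt ext e)"
    unfolding arcs_def by blast
  then obtain E s' t' where E: "E \<in> ext_edges" and st: "s' \<in> set (ext_src E)" "t' \<in> set (ext_tgt E)"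
      "s = to_nat s'" "t = to_nat t'"
    by auto
  have "(to_nat s', to_nat t') \<in> increasing"
    unfolding increasing_iff using E
  proof (cases rule: ext_edges_cases)
    case (1 e)
    then show "(anchor s', anchor t') \<in> (arcs H)\<^sup>+ \<or> anchor s' = anchor t' \<and> height s' < height t'"
      using st hom_arcs[OF hom_m] arcsI by fastforce
  next
    case (2 y x)
    then show "(anchor s', anchor t') \<in> (arcs H)\<^sup>+ \<or> anchor s' = anchor t' \<and> height s' < height t'"
      using st fork_src_height[of y x] by auto
  next
    \<comment> \<open>From \<open>Mid y x\<close> the anchor jumps from \<open>y\<close> to
      \<open>x\<close>, which is paid for by \<open>(y, x) \<in> R\<close>; from
      \<open>Join_In y x\<close> the anchor stays and the height grows.\<close>
    case (3 y x)
    then show "(anchor s', anchor t') \<in> (arcs H)\<^sup>+ \<or> anchor s' = anchor t' \<and> height s' < height t'"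
      using st join_tgt_height[of y x] R_iff[of y x] by auto
  qed
  then show "(s, t) \<in> increasing" using st by simp
qed

lemma arcs_ext_trancl: "(arcs ext)\<^sup>+ \<subseteq> increasing"
  using trancl_mono_subset[OF arcs_ext_increasing] trancl_id[OF trans_increasing] by simp

lemma ext_ma_hypergraph: "ma_hypergraph (ext_sig \<Sigma>) ext"
proof -
  have "(v, v) \<notin> (arcs ext)\<^sup>+" for v
    using arcs_ext_trancl ma_H by (auto simp: increasing_def ma_hypergraph_iff acyclic_def)
  then show ?thesis
    using ext_hypergraph ext_disjoint_sources ext_disjoint_targets
        by (simp add: ma_hypergraph_iff acyclic_def)
qed

section \<open>Reachability and convexity in the extension\<close>

lemma hom_emb: "hom G ext emb" and mono_emb: "mono_mor G emb"
  by (auto simp: hom_def mono_mor_def emb_def ext_nodes_def ext_edges_def inj_on_def)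

lemma arcs_extI: "E \<in> ext_edges \<Longrightarrow> s \<in> set (ext_src E) \<Longrightarrow> t \<in> set (ext_tgt E) \<Longrightarrow>
    (to_nat s, to_nat t) \<in> arcs ext"
  by (rule arcsI[of "to_nat E"]) simp_all

text \<open>\<open>Fork_Out\<close> is carried through the induction because the next fork of the
  chain starts there.\<close>

lemma reach_mid:
  assumes "(y, x) \<in> R"
  shows "(to_nat (Old y), to_nat (Fork_Out y x)) \<in> (arcs ext)\<^sup>+ \<and>
      (to_nat (Old y), to_nat (Mid y x)) \<in> (arcs ext)\<^sup>+"
  using assms
proof (induction x rule: less_induct)
  case (less x)
  have E: "Fork_Edge y x \<in> ext_edges" using less.prems by (auto simp: ext_edges_def)
  have a: "(to_nat (fork_src y x), to_nat (Fork_Out y x)) \<in> arcs ext"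
      "(to_nat (fork_src y x), to_nat (Mid y x)) \<in> arcs ext"
    by (rule arcs_extI[OF E]; simp)+
  show ?case
  proof (rule fork_src_cases[of y x])
    assume "fork_src y x = Old y"
    then show ?thesis using a by auto
  next
    fix x' assume "fork_src y x = Fork_Out y x'" "(y, x') \<in> R" "x' < x"
    then show ?thesis using a less.IH[of x'] by (auto intro: trancl_into_trancl)
  qed
qed

lemma reach_from_mid:
  assumes "(y, x) \<in> R"
  shows "(to_nat (Join_In y x), to_nat (Old x)) \<in> (arcs ext)\<^sup>+ \<and>
      (to_nat (Mid y x), to_nat (Old x)) \<in> (arcs ext)\<^sup>+"
  using assms
proof (induction y rule: less_induct)
  case (less y)
  have E: "Join_Edge y x \<in> ext_edges" using less.prems by (auto simp: ext_edges_def)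
  have a: "(to_nat (Join_In y x), to_nat (join_tgt y x)) \<in> arcs ext"
      "(to_nat (Mid y x), to_nat (join_tgt y x)) \<in> arcs ext"
    by (rule arcs_extI[OF E]; simp)+
  show ?case
  proof (rule join_tgt_cases[of x y])
    assume "join_tgt y x = Old x"
    then show ?thesis using a by auto
  next
    fix y' assume "join_tgt y x = Join_In y' x" "(y', x) \<in> R" "y' < y"
    then show ?thesis using a less.IH[of y'] by (auto intro: trancl_into_trancl2)
  qed
qed

text \<open>Old nodes all have height 0, so an increase between two of them can only come from a
  nonempty path in \<open>H\<close>.\<close>

lemma ext_path_iff:
  assumes "y \<in> outputs G" "x \<in> inputs G"
  shows "(fst emb y, fst emb x) \<in> (arcs ext)\<^sup>+ \<longleftrightarrow> (y, x) \<in> R"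
proof
  assume "(fst emb y, fst emb x) \<in> (arcs ext)\<^sup>+"
  then have "(to_nat (Old y), to_nat (Old x)) \<in> increasing"
    using arcs_ext_trancl by (auto simp: emb_def)
  then show "(y, x) \<in> R"
    using assms by (simp add: increasing_iff R_iff outputs_eq[OF hyper_G] inputs_eq[OF hyper_G])
next
  assume "(y, x) \<in> R"
  then show "(fst emb y, fst emb x) \<in> (arcs ext)\<^sup>+"
    using reach_mid reach_from_mid by (fastforce simp: emb_def intro: trancl_trans)
qed

lemma path_extension_ext: "path_extension \<Sigma> G R ext emb"
proof -
  have "lab ext e \<in> range Inr" if "e \<in> edges ext - snd emb ` edges G" for e
  proof -
    from that obtain E where "E \<in> ext_edges" "e = to_nat E" "E \<notin> Old_Edge ` edges G"
      by (auto simp: emb_def)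
    then show ?thesis by (auto elim!: ext_edges_cases)
  qed
  then show ?thesis
    unfolding path_extension_def path_from_to_iff
    using ext_ma_hypergraph hom_emb mono_emb ext_path_iff by blast
qed

lemma path_relation_ext: "path_relation G ext emb = R"
proof -
  have "R \<subseteq> outputs G \<times> inputs G" by (auto simp: path_relation_def)
  moreover have "path_relation G ext emb = {(y, x) \<in> outputs G \<times> inputs G. (fst emb y, fst emb x)
      \<in> (arcs ext)\<^sup>+}"
    by (simp add: path_relation_def path_from_to_iff)
  ultimately show ?thesis using ext_path_iff by auto
qed

text \<open>A loss of height must be paid for by a nonempty path in \<open>H\<close>. This is how a
  passage through a fork or a join becomes visible there.\<close>

lemma arcs_ext_rtrancl_anchor:
  assumes "(to_nat s, to_nat t) \<in> (arcs ext)\<^sup>*"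
  shows "(anchor s, anchor t) \<in> (arcs H)\<^sup>*" "anchor s \<noteq> anchor t \<or> height s > height t \<Longrightarrow>
      (anchor s, anchor t) \<in> (arcs H)\<^sup>+"
proof -
  have "s = t \<or> (to_nat s, to_nat t) \<in> increasing"
    using assms arcs_ext_trancl by (auto simp: rtrancl_eq_or_trancl)
  then show "(anchor s, anchor t) \<in> (arcs H)\<^sup>*"
      "anchor s \<noteq> anchor t \<or> height s > height t \<Longrightarrow> (anchor s, anchor t) \<in> (arcs H)\<^sup>+"
    unfolding increasing_iff by (auto dest: trancl_into_rtrancl)
qed

text \<open>Old edges are judged in \<open>H\<close>. A new edge lies on no path between match
  nodes: such a path would yield one in \<open>H\<close> that leaves the image of an output
  \<open>y\<close> of \<open>G\<close>, or enters the image of an input \<open>x\<close>. By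
  convexity its edge there is the image of an edge of \<open>G\<close>, making \<open>y\<close> a
  source or \<open>x\<close> a target.\<close>

lemma convex_match_ext:
  assumes f: "hom L G f" and conv: "convex_match L H (m \<odot> f)"
  shows "convex_match L ext (emb \<odot> f)"
  unfolding convex_match_iff
proof (intro conjI ballI impI)
  have mn: "inj_on (fst m) (nodes G)" and me: "inj_on (snd m) (edges G)"
    using mono_m by (simp_all add: mono_mor_def)
  have mono_mf: "mono_mor L (m \<odot> f)"
    using conv unfolding convex_match_def by blast
  have conv': "\<exists>d\<in>edges L. e = snd m (snd f d)"
    if "v \<in> fst f ` nodes L" "w \<in> fst f ` nodes L" "e \<in> edges H" "s \<in> set (src H e)"
        "t \<in> set (tgt H e)"
      "(fst m v, s) \<in> (arcs H)\<^sup>*" "(t, fst m w) \<in> (arcs H)\<^sup>*" for v w e s t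
  proof -
    have "fst m v \<in> fst (m \<odot> f) ` nodes L" "fst m w \<in> fst (m \<odot> f) ` nodes L" using that by auto
    then have "e \<in> snd (m \<odot> f) ` edges L" using conv that(3-7) unfolding convex_match_iff by blast
    then show ?thesis by auto
  qed
  show "hom L ext (emb \<odot> f)" by (rule hom_comp[OF f hom_emb])
  have "inj_on (fst f) (nodes L)" "inj_on (snd f) (edges L)"
    using mono_mf by (auto simp: mono_mor_def inj_on_def)
  then show "mono_mor L (emb \<odot> f)" by (auto simp: mono_mor_def emb_def inj_on_def)
  fix v' w' e s t
  assume v': "v' \<in> fst (emb \<odot> f) ` nodes L" and w': "w' \<in> fst (emb \<odot> f) ` nodes L"
      and e: "e \<in> edges ext"
    and s: "s \<in> set (src ext e)" and t: "t \<in> set (tgt ext e)"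
    and vs: "(v', s) \<in> (arcs ext)\<^sup>*" and tw: "(t, w') \<in> (arcs ext)\<^sup>*"
  obtain v w where v: "v \<in> fst f ` nodes L" "v' = to_nat (Old v)" and w: "w \<in> fst f ` nodes L"
      "w' = to_nat (Old w)"
    using v' w' by (auto simp: emb_def)
  obtain E where E: "E \<in> ext_edges" "e = to_nat E" using e by auto
  obtain a b where a: "a \<in> set (ext_src E)" "s = to_nat a" and b: "b \<in> set (ext_tgt E)"
      "t = to_nat b"
    using s t E by auto
  note va = arcs_ext_rtrancl_anchor[OF vs[unfolded v a]]
      and bw = arcs_ext_rtrancl_anchor[OF tw[unfolded w b]]
  from E(1) show "e \<in> snd (emb \<odot> f) ` edges L"
  proof (cases rule: ext_edges_cases)
    case (1 d)
    then obtain a' b' where ab: "a = Old a'" "b = Old b'" "a' \<in> set (src G d)" "b' \<in> set (tgt G d)"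
      using a b by auto
    have "\<exists>d'\<in>edges L. snd m d = snd m (snd f d')"
      by (rule conv'[OF v(1) w(1), of _ "fst m a'" "fst m b'"])
        (use homD[OF hom_m, of d] 1 ab va(1) bw(1) in simp_all)
    then obtain d' where d': "d' \<in> edges L" "snd m d = snd m (snd f d')" by blast
    then have "d = snd f d'" using inj_onD[OF me] 1(2) homD(2)[OF f] by blast
    then show ?thesis using d' 1 E by (simp add: emb_def)
  next
    case (2 y x)
    have y: "y \<in> nodes G" "y \<notin> sources G" using R_iff 2(2) by blast+
    \<comment> \<open>Both targets of a fork have positive height and \<open>Old w\<close> has
      height 0, so the descent forces a nonempty path in \<open>H\<close>.\<close>
    have "(fst m y, fst m w) \<in> (arcs H)\<^sup>+" using bw(2) b 2(1) by auto
    then obtain u where "(fst m y, u) \<in> arcs H" and u: "(u, fst m w) \<in> (arcs H)\<^sup>*"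
        by (meson tranclD)
    then obtain d where d: "d \<in> edges H" "fst m y \<in> set (src H d)" "u \<in> set (tgt H d)"
        unfolding arcs_def by blast
    have "(fst m v, fst m y) \<in> (arcs H)\<^sup>*" using va(1) a 2(1) by simp
    from conv'[OF v(1) w(1) d this u] obtain d' where d': "d' \<in> edges L" "d = snd m (snd f d')"
        by blast
    then have fd: "snd f d' \<in> edges G" using homD(2)[OF f] by blast
    then have "fst m y \<in> fst m ` set (src G (snd f d'))" using homD(4)[OF hom_m fd] d' d(2) by simp
    then obtain z where z: "z \<in> set (src G (snd f d'))" "fst m y = fst m z" by blast
    then have "z \<in> sources G" using fd unfolding ends_def by blast
    moreover then have "y = z" using inj_onD[OF mn z(2) y(1)] hypergraph_ends(1)[OF hyper_G]
        by blast
    ultimately show ?thesis using y(2) by blast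
  next
    case (3 y x)
    have x: "x \<in> nodes G" "x \<notin> targets G" and yx: "(fst m y, fst m x) \<in> (arcs H)\<^sup>+"
        using R_iff 3(2) by blast+
    \<comment> \<open>From \<open>Mid y x\<close> the path behind the pair \<open>(y, x)\<close> is
      appended; \<open>Join_In y x\<close> has negative height, so reaching it from
      \<open>Old v\<close> already forces a nonempty path.\<close>
    have "(fst m v, fst m x) \<in> (arcs H)\<^sup>+"
    proof -
      consider "a = Mid y x" | "a = Join_In y x" using a 3 by auto
      then show ?thesis
      proof cases
        case 1
        then show ?thesis using va(1) yx by (auto intro: rtrancl_trancl_trancl)
      next
        case 2
        then show ?thesis using va(2) by simp
      qed
    qed
    then obtain u where u: "(fst m v, u) \<in> (arcs H)\<^sup>*" and "(u, fst m x) \<in> arcs H"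
        by (meson tranclD2)
    then obtain d where d: "d \<in> edges H" "u \<in> set (src H d)" "fst m x \<in> set (tgt H d)"
        unfolding arcs_def by blast
    have "(fst m x, fst m w) \<in> (arcs H)\<^sup>*" using bw(1) b 3(1) by simp
    from conv'[OF v(1) w(1) d u this] obtain d' where d': "d' \<in> edges L" "d = snd m (snd f d')"
        by blast
    then have fd: "snd f d' \<in> edges G" using homD(2)[OF f] by blast
    then have "fst m x \<in> fst m ` set (tgt G (snd f d'))" using homD(5)[OF hom_m fd] d' d(3) by simp
    then obtain z where z: "z \<in> set (tgt G (snd f d'))" "fst m x = fst m z" by blast
    then have "z \<in> targets G" using fd unfolding ends_def by blast
    moreover then have "x = z" using inj_onD[OF mn z(2) x(1)] hypergraph_ends(2)[OF hyper_G]
        by blast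
    ultimately show ?thesis using x(2) by blast
  qed
qed

end

section \<open>Path joinability\<close>

lemma ma_hypergraph_base_ext: "ma_hypergraph (base_sig \<Sigma>) G \<Longrightarrow> ma_hypergraph (ext_sig \<Sigma>) G"
  by (auto simp: ma_hypergraph_def hypergraph_def base_sig_def ext_sig_def)

lemma ma_rule_base_ext: "ma_rule (base_sig \<Sigma>) r \<Longrightarrow> ma_rule (ext_sig \<Sigma>) r"
  by (simp add: ma_rule_def ma_cospan_def ma_hypergraph_base_ext)

text \<open>The extension comes without an interface; any enumeration of its inputs and outputs
  supplies one.\<close>

lemma ma_ihypergraph_exists:
  assumes "ma_hypergraph S P"
  obtains X where "ma_ihypergraph S X" "carrier X = P"
proof -
  have fin: "finite (inputs P)" "finite (outputs P)"
    using assms by (auto simp: inputs_def outputs_def ma_hypergraph_def hypergraph_def)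
  obtain f g where f: "bij_betw f {0..<card (inputs P)} (inputs P)"
      and g: "bij_betw g {0..<card (outputs P)} (outputs P)"
    using ex_bij_betw_nat_finite[OF fin(1)] ex_bij_betw_nat_finite[OF fin(2)] by blast
  let ?X = "\<lparr> carrier = P, dom_size = card (inputs P), cod_size = card (outputs P), dom_leg =
      (f, id), cod_leg = (g, id) \<rparr>"
  have "ma_ihypergraph S ?X"
    using assms f g
    by (auto simp: ma_ihypergraph_def ma_cospan_def hom_disc_iff mono_mor_disc_iff bij_betw_def
        atLeast0LessThan inputs_def outputs_def)
  then show ?thesis using that[of ?X] by simp
qed

lemma performed_along_exists:
  assumes r: "ma_rule S r" and t: "dpo_step S r X Y t" and X': "ma_ihypergraph S X'"
    and p: "hom (carrier X) (carrier X') p" "mono_mor (carrier X) p"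
    and conv: "convex_match (lhs r) (carrier X') (p \<odot> mtch t)"
  obtains Y' t' where "performed_along S r p X t X' Y' t'"
proof -
  obtain Y' t' where t': "convex_step_by S r X' Y' t'" "mtch t' = p \<odot> mtch t"
    "gluing (rule_i r + rule_j r) (lhs r) (ctxt t') (carrier X')
       (copair (rule_i r) (lhs_i r) (lhs_j r)) (ctxt_rule r t') (p \<odot> mtch t) (ctxt_left t')"
    by (rule convex_step_exists[OF r X' conv])
  have "performed_along S r p X t X' Y' t'"
    unfolding performed_along_def
    using t' boundary_complement_context_along[OF r t _ p t'] by (auto simp: mor_eq_def)
  then show ?thesis using that by blast
qed

theorem mainTheorem7:
  fixes \<Sigma> :: "'s signature" and \<R> :: "('s + path_gen) rule set"
  assumes "convex_rewriting_system \<Sigma> \<R>"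
    and "locally_confluent_on (ext_sig \<Sigma>) \<R> {X. ma_ihypergraph (ext_sig \<Sigma>) X}"
  shows "\<forall>r\<^sub>1 r\<^sub>2 X Y\<^sub>1 Y\<^sub>2 t\<^sub>1 t\<^sub>2.
    ma_pre_critical_pair (ext_sig \<Sigma>) \<R> r\<^sub>1 r\<^sub>2 X Y\<^sub>1 Y\<^sub>2 t\<^sub>1 t\<^sub>2 \<longrightarrow>
    path_joinable \<Sigma> \<R> r\<^sub>1 r\<^sub>2 X t\<^sub>1 t\<^sub>2"
proof (intro allI impI)
  fix r\<^sub>1 r\<^sub>2 X Y\<^sub>1 Y\<^sub>2 t\<^sub>1 t\<^sub>2
  let ?S = "ext_sig \<Sigma>"
  assume cp: "ma_pre_critical_pair ?S \<R> r\<^sub>1 r\<^sub>2 X Y\<^sub>1 Y\<^sub>2 t\<^sub>1 t\<^sub>2"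
  then have r: "r\<^sub>1 \<in> \<R>" "r\<^sub>2 \<in> \<R>" and t: "dpo_step ?S r\<^sub>1 X Y\<^sub>1 t\<^sub>1" "dpo_step ?S r\<^sub>2 X Y\<^sub>2 t\<^sub>2"
    and X: "ma_hypergraph ?S (carrier X)"
    by (simp_all add: ma_pre_critical_pair_def ma_ihypergraph_def ma_cospan_def)
  have f: "hom (lhs r\<^sub>1) (carrier X) (mtch t\<^sub>1)" "hom (lhs r\<^sub>2) (carrier X) (mtch t\<^sub>2)"
    using t by (simp_all add: dpo_step_def pushout_def)
  have ma: "ma_rule ?S r\<^sub>1" "ma_rule ?S r\<^sub>2"
    using assms(1) r ma_rule_base_ext by (auto simp: convex_rewriting_system_def)
  show "path_joinable \<Sigma> \<R> r\<^sub>1 r\<^sub>2 X t\<^sub>1 t\<^sub>2"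
    unfolding path_joinable_def
  proof (intro allI impI)
    fix R assume "maximal_path_relation ?S (lhs r\<^sub>1) (lhs r\<^sub>2) (carrier X) (mtch t\<^sub>1) (mtch t\<^sub>2) R"
    then obtain H m where H: "ma_hypergraph ?S H" "hom (carrier X) H m" "mono_mor (carrier X) m"
      and R: "path_relation (carrier X) H m = R"
      and conv: "convex_match (lhs r\<^sub>1) H (m \<odot> mtch t\<^sub>1)" "convex_match (lhs r\<^sub>2) H (m \<odot> mtch t\<^sub>2)"
      unfolding maximal_path_relation_def convex_path_relation_def by blast
    \<comment> \<open>From here on \<open>ext\<close> replaces \<open>H\<close>: it realises the
      same relation and adds only path generators.\<close>
    interpret realised_path_relation \<Sigma> "carrier X" H m
      using X H by unfold_locales
    obtain P where P: "ma_ihypergraph ?S P" "carrier P = ext"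
      by (rule ma_ihypergraph_exists[OF ext_ma_hypergraph])
    obtain Y\<^sub>1' u\<^sub>1 where u1: "performed_along ?S r\<^sub>1 emb X t\<^sub>1 P Y\<^sub>1' u\<^sub>1"
      by (rule performed_along_exists[OF ma(1) t(1) P(1), of emb])
        (use P(2) hom_emb mono_emb convex_match_ext[OF f(1) conv(1)] in simp_all)
    obtain Y\<^sub>2' u\<^sub>2 where u2: "performed_along ?S r\<^sub>2 emb X t\<^sub>2 P Y\<^sub>2' u\<^sub>2"
      by (rule performed_along_exists[OF ma(2) t(2) P(1), of emb])
        (use P(2) hom_emb mono_emb convex_match_ext[OF f(2) conv(2)] in simp_all)
    \<comment> \<open>Both steps start from the same \<open>P\<close> with the same interface, so
      they form a branching to which local confluence applies.\<close>
    have "convex_step ?S \<R> P Y\<^sub>1'" "convex_step ?S \<R> P Y\<^sub>2'"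
      using u1 u2 r unfolding convex_step_def performed_along_def by blast+
    then have "convex_joinable ?S \<R> Y\<^sub>1' Y\<^sub>2'"
      using assms(2) P(1) unfolding locally_confluent_on_def by blast
    moreover have "path_extension \<Sigma> (carrier X) R (carrier P) emb"
        "path_relation (carrier X) (carrier P) emb = R"
      using path_extension_ext path_relation_ext R P(2) by simp_all
    ultimately show "\<exists>P p. path_extension \<Sigma> (carrier X) R (carrier P) p \<and>
           path_relation (carrier X) (carrier P) p = R \<and>
           (\<exists>Y\<^sub>1 Y\<^sub>2 u\<^sub>1 u\<^sub>2.
              performed_along ?S r\<^sub>1 p X t\<^sub>1 P Y\<^sub>1 u\<^sub>1 \<and>
              performed_along ?S r\<^sub>2 p X t\<^sub>2 P Y\<^sub>2 u\<^sub>2 \<and>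
              convex_joinable ?S \<R> Y\<^sub>1 Y\<^sub>2)"
      using u1 u2 by blast
  qed
qed

end
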